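(* Let $\mathcal{H}^+=-\frac{1}{4\pi}\Delta+\pi|x|^2$ on $\mathbb{R}^d$ and $\mathcal{I}=(-\pi/4,\pi/4)$. Assume that $d,p,q\ge1$ satisfy $$\frac{2}{q}+\frac{d}{p}=d\quad\text{and}\quad 1\le p<\frac{d+1}{d-1}.$$ Then, for every $r>\frac{2p}{p+1}$, $$\sup_{\gamma\in\mathfrak{S}^r,\ \gamma\ne0}\frac{\big\|\rho_{e^{it\mathcal{H}^+}\gamma e^{-it\mathcal{H}^+}}\big\|_{L^q_t(\mathcal{I},\,\mathcal{W}_x^{p',p}(\mathbb{R}^d))}}{\|\gamma\|_{\mathfrak{S}^r}}=+\infty.$$
   Context: Primes denote conjugate exponents; $q=\infty$ is allowed. For $d=1$ the quantity $\frac{d+1}{d-1}$ is read as $+\infty$. $\mathfrak{S}^r=\mathfrak{S}^r(L^2(\mathbb{R}^d))$ is the Schatten class with norm the $\ell^r$ norm of the singular values. For an operator $\gamma=\sum_j\alpha_j|f_j\rangle\langle f_j|$ with $(f_j)_j$ orthonormal in $L^2(\mathbb{R}^d)$ and $\alpha_j\in\mathbb{C}$, the density of the evolved operator is $\rho_{e^{it\mathcal{H}^+}\gamma e^{-it\mathcal{H}^+}}=\sum_j\alpha_j|e^{it\mathcal{H}^+}f_j|^2$, and $\|\gamma\|_{\mathfrak{S}^r}=(\sum_j|\alpha_j|^r)^{1/r}$; the supremum is over such operators. Fix a nonzero test function $g\in C_0^\infty(\mathbb{R}^d)$ and put $T_xg(y)=g(y-x)$. For $1\le a,b\le\infty$,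 the Wiener amalgam space $\mathcal{W}^{a,b}=\mathcal{W}(\mathcal{F}L^a,L^b)$ on $\mathbb{R}^d$ has norm $\big\|\,\|f\,T_xg\|_{\mathcal{F}L^a}\big\|_{L^b_x}$, where $\|h\|_{\mathcal{F}L^a}=\|\mathcal{F}h\|_{L^a}$ and $\mathcal{F}$ is the Fourier transform (different choices of $g$ give equivalent norms). $\|F\|_{L^q_t(\mathcal{I},\mathcal{W}_x^{a,b})}=\big\|\,\|F(t,\cdot)\|_{\mathcal{W}^{a,b}}\big\|_{L^q_t(\mathcal{I})}$. $e^{it\mathcal{H}^+}$ is the unitary group on $L^2(\mathbb{R}^d)$ generated by $\mathcal{H}^+$. *)

theory Defs
  imports "HOL-Analysis.Analysis"
begin

section \<open>Lebesgue norms with extended exponents and values\<close>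

text \<open>Exponents range over \<open>ennreal\<close>, where \<open>1 / \<infinity> = 0\<close> and \<open>x / 0 = \<infinity>\<close> for \<open>x > 0\<close>. In particular
  the conjugate of \<open>1\<close> is \<open>\<infinity>\<close> and vice versa.\<close>

definition conjugate_exponent :: "ennreal \<Rightarrow> ennreal" where
  "conjugate_exponent p = inverse (1 - inverse p)"

definition ennreal_powr :: "ennreal \<Rightarrow> real \<Rightarrow> ennreal" where
  "ennreal_powr x s = (if x = \<infinity> then \<infinity> else ennreal (enn2real x powr s))"  \<comment> \<open>used for \<open>s > 0\<close> only\<close>

definition Lp_norm :: "ennreal \<Rightarrow> 'a measure \<Rightarrow> ('a \<Rightarrow> ennreal) \<Rightarrow> ennreal" where
  "Lp_norm p M F =
     (if p = \<infinity> then Inf {c. AE x in M. F x \<le> c}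
      else ennreal_powr (\<integral>\<^sup>+x. ennreal_powr (F x) (enn2real p) \<partial>M) (1 / enn2real p))"

section \<open>The Hilbert space of square-integrable functions\<close>

text \<open>Elements of \<open>L\<^sup>2\<close> are handled through Borel representatives; all notions below only depend
  on them up to equality almost everywhere.\<close>

definition L2_norm :: "('a::euclidean_space \<Rightarrow> complex) \<Rightarrow> ennreal" where
  "L2_norm f = Lp_norm 2 lborel (\<lambda>x. ennreal (cmod (f x)))"

definition L2 :: "('a::euclidean_space \<Rightarrow> complex) set" where
  "L2 = {f \<in> borel_measurable lborel. L2_norm f < \<infinity>}"

definition L2_inner :: "('a::euclidean_space \<Rightarrow> complex) \<Rightarrow> ('a \<Rightarrow> complex) \<Rightarrow> complex" where
  "L2_inner f h = (\<integral>x. cnj (f x) * h x \<partial>lborel)"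

definition L2_orthonormal :: "(nat \<Rightarrow> 'a::euclidean_space \<Rightarrow> complex) \<Rightarrow> bool" where
  "L2_orthonormal f \<longleftrightarrow>
     (\<forall>j. f j \<in> L2) \<and> (\<forall>j k. L2_inner (f j) (f k) = (if j = k then 1 else 0))"

section \<open>Smooth functions\<close>

definition partial_deriv :: "'a::euclidean_space \<Rightarrow> ('a \<Rightarrow> complex) \<Rightarrow> 'a \<Rightarrow> complex" where
  "partial_deriv b f x = frechet_derivative f (at x) b"

definition smooth :: "('a::euclidean_space \<Rightarrow> complex) \<Rightarrow> bool" where
  "smooth f \<longleftrightarrow>
     (\<forall>bs. set bs \<subseteq> Basis \<longrightarrow> (\<forall>x. foldr partial_deriv bs f differentiable (at x)))"

definition test_function :: "('a::euclidean_space \<Rightarrow> complex) \<Rightarrow> bool" where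
  "test_function f \<longleftrightarrow> smooth f \<and> (\<exists>K. compact K \<and> (\<forall>x. x \<notin> K \<longrightarrow> f x = 0))"

definition schwartz_function :: "('a::euclidean_space \<Rightarrow> complex) \<Rightarrow> bool" where
  "schwartz_function f \<longleftrightarrow> smooth f \<and>
     (\<forall>bs k. set bs \<subseteq> Basis \<longrightarrow> bounded (range (\<lambda>x. norm x ^ k *\<^sub>R foldr partial_deriv bs f x)))"

section \<open>The harmonic oscillator and the unitary group it generates\<close>

definition laplacian :: "('a::euclidean_space \<Rightarrow> complex) \<Rightarrow> 'a \<Rightarrow> complex" where
  "laplacian f x = (\<Sum>b\<in>Basis. partial_deriv b (partial_deriv b f) x)"

definition harmonic_oscillator :: "('a::euclidean_space \<Rightarrow> complex) \<Rightarrow> 'a \<Rightarrow> complex" where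
  "harmonic_oscillator f x =
     - complex_of_real (1 / (4 * pi)) * laplacian f x + complex_of_real (pi * (norm x)\<^sup>2) * f x"

definition unitary_group :: "(real \<Rightarrow> ('a::euclidean_space \<Rightarrow> complex) \<Rightarrow> 'a \<Rightarrow> complex) \<Rightarrow> bool" where
  "unitary_group U \<longleftrightarrow>
     (\<forall>t. \<forall>f\<in>L2. U t f \<in> L2 \<and> L2_norm (U t f) = L2_norm f) \<and>
     (\<forall>t. \<forall>f\<in>L2. \<forall>h\<in>L2. \<forall>a b. AE x in lborel.
        U t (\<lambda>y. a * f y + b * h y) x = a * U t f x + b * U t h x) \<and>
     (\<forall>f\<in>L2. AE x in lborel. U 0 f x = f x) \<and>
     (\<forall>s t. \<forall>f\<in>L2. AE x in lborel. U (s + t) f x = U s (U t f) x) \<and>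
     (\<forall>f\<in>L2. ((\<lambda>t. L2_norm (\<lambda>x. U t f x - f x)) \<longlongrightarrow> 0) (at 0))"

text \<open>\<open>U t = e\<^bsup>i t H\<^esup>\<close>. The operators \<open>H\<close> of interest are essentially self-adjoint on the Schwartz
  space. By Stone's theorem there is then exactly one group with this property (up to equality
  almost everywhere), and its generator is \<open>i\<close> times the closure of \<open>H\<close>.\<close>

definition generates_unitary_group ::
  "(('a::euclidean_space \<Rightarrow> complex) \<Rightarrow> 'a \<Rightarrow> complex) \<Rightarrow>
   (real \<Rightarrow> ('a \<Rightarrow> complex) \<Rightarrow> 'a \<Rightarrow> complex) \<Rightarrow> bool" where
  "generates_unitary_group H U \<longleftrightarrow> unitary_group U \<and>
     (\<forall>f. schwartz_function f \<longrightarrow>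
        ((\<lambda>t. L2_norm (\<lambda>x. (U t f x - f x) / complex_of_real t - \<i> * H f x)) \<longlongrightarrow> 0) (at 0))"

section \<open>Schatten class operators and densities\<close>

text \<open>\<open>\<gamma> = \<Sum>\<^sub>j \<alpha>\<^sub>j |f\<^sub>j\<rangle>\<langle>f\<^sub>j|\<close>, with strong convergence. Coefficients may vanish, so finite sums are
  covered: \<open>L\<^sup>2\<close> is infinite-dimensional and finite orthonormal families extend to sequences.\<close>

definition spectral_form ::
  "(('a::euclidean_space \<Rightarrow> complex) \<Rightarrow> 'a \<Rightarrow> complex) \<Rightarrow> (nat \<Rightarrow> complex) \<Rightarrow>
   (nat \<Rightarrow> 'a \<Rightarrow> complex) \<Rightarrow> bool" where
  "spectral_form \<gamma> \<alpha> f \<longleftrightarrow> L2_orthonormal f \<and>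
     (\<forall>u\<in>L2. \<gamma> u \<in> L2 \<and>
        (\<lambda>n. L2_norm (\<lambda>x. \<gamma> u x - (\<Sum>j<n. \<alpha> j * L2_inner (f j) u * f j x))) \<longlonglongrightarrow> 0)"

definition schatten_norm :: "ennreal \<Rightarrow> (nat \<Rightarrow> complex) \<Rightarrow> ennreal" where
  "schatten_norm r \<alpha> = Lp_norm r (count_space UNIV) (\<lambda>j. ennreal (cmod (\<alpha> j)))"

text \<open>The condition \<open>\<alpha> \<longlonglongrightarrow> 0\<close> only matters for \<open>r = \<infinity>\<close>, where it expresses compactness of \<open>\<gamma>\<close>.\<close>

definition schatten_coefficients :: "ennreal \<Rightarrow> (nat \<Rightarrow> complex) \<Rightarrow> bool" where
  "schatten_coefficients r \<alpha> \<longleftrightarrow> \<alpha> \<longlonglongrightarrow> 0 \<and> schatten_norm r \<alpha> < \<infinity>"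

definition operator_nonzero ::
  "(('a::euclidean_space \<Rightarrow> complex) \<Rightarrow> 'a \<Rightarrow> complex) \<Rightarrow> bool" where
  "operator_nonzero \<gamma> \<longleftrightarrow> (\<exists>u\<in>L2. \<not> (AE x in lborel. \<gamma> u x = 0))"

definition evolved_density ::
  "(real \<Rightarrow> ('a::euclidean_space \<Rightarrow> complex) \<Rightarrow> 'a \<Rightarrow> complex) \<Rightarrow> (nat \<Rightarrow> complex) \<Rightarrow>
   (nat \<Rightarrow> 'a \<Rightarrow> complex) \<Rightarrow> real \<Rightarrow> 'a \<Rightarrow> complex" where
  "evolved_density U \<alpha> f t x = (\<Sum>j. \<alpha> j * complex_of_real ((cmod (U t (f j) x))\<^sup>2))"

text \<open>For coefficients that are not absolutely summable the series defining the density need not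
  converge. The density is a well-defined locally integrable function (so that its Wiener amalgam
  norms make sense) if the series of absolute values is locally integrable, which is automatic for
  trace class \<open>\<gamma>\<close>.\<close>

definition density_defined ::
  "(real \<Rightarrow> ('a::euclidean_space \<Rightarrow> complex) \<Rightarrow> 'a \<Rightarrow> complex) \<Rightarrow> real set \<Rightarrow> (nat \<Rightarrow> complex) \<Rightarrow>
   (nat \<Rightarrow> 'a \<Rightarrow> complex) \<Rightarrow> bool" where
  "density_defined U I \<alpha> f \<longleftrightarrow>
     (AE t in restrict_space lborel I. \<forall>K. compact K \<longrightarrow>
        (\<integral>\<^sup>+x\<in>K. (\<Sum>j. ennreal (cmod (\<alpha> j) * (cmod (U t (f j) x))\<^sup>2)) \<partial>lborel) < \<infinity>)"

section \<open>Wiener amalgam norms\<close>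

definition fourier :: "('a::euclidean_space \<Rightarrow> complex) \<Rightarrow> 'a \<Rightarrow> complex" where
  "fourier h \<xi> = (\<integral>y. cis (- 2 * pi * (y \<bullet> \<xi>)) * h y \<partial>lborel)"

definition fourier_Lp_norm :: "ennreal \<Rightarrow> ('a::euclidean_space \<Rightarrow> complex) \<Rightarrow> ennreal" where
  "fourier_Lp_norm a h = Lp_norm a lborel (\<lambda>\<xi>. ennreal (cmod (fourier h \<xi>)))"

definition translate :: "'a::euclidean_space \<Rightarrow> ('a \<Rightarrow> complex) \<Rightarrow> 'a \<Rightarrow> complex" where
  "translate x g y = g (y - x)"

definition wiener_norm ::
  "('a::euclidean_space \<Rightarrow> complex) \<Rightarrow> ennreal \<Rightarrow> ennreal \<Rightarrow> ('a \<Rightarrow> complex) \<Rightarrow> ennreal" where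
  "wiener_norm g a b f =
     Lp_norm b lborel (\<lambda>x. fourier_Lp_norm a (\<lambda>y. f y * translate x g y))"

definition mixed_wiener_norm ::
  "('a::euclidean_space \<Rightarrow> complex) \<Rightarrow> ennreal \<Rightarrow> real set \<Rightarrow> ennreal \<Rightarrow> ennreal \<Rightarrow>
   (real \<Rightarrow> 'a \<Rightarrow> complex) \<Rightarrow> ennreal" where
  "mixed_wiener_norm g q I a b F =
     Lp_norm q (restrict_space lborel I) (\<lambda>t. wiener_norm g a b (F t))"

end

theory Submission
  imports Defs "HOL-Probability.Sinc_Integral"
begin

text \<open>The supremum is infinite because spectral projections of \<open>\<H>\<^sup>+\<close> onto low energies are too large. Let
  \<open>\<gamma>\<close> be the projection onto the span of the \<open>N = m\<^sup>d\<close> Hermite functions on \<open>\<real>\<^sup>d\<close> whose indices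
  are all less than \<open>m\<close>. Each of them is an eigenfunction, so the group only multiplies it by a phase
  (\<open>eigenfunction_evolution\<close>) and the density \<open>\<rho>\<close> of the evolved operator does not depend on time.
  It has mass \<open>N\<close>. By the virial theorem its second moment is comparable to the total energy, which is
  of order \<open>N m\<close>. Hence most of the mass lies in a ball of radius of order \<open>m\<^bsup>1/2\<^esup>\<close>.

  A lower bound for the amalgam norm of such a density needs only these two facts
  (\<open>wiener_norm_lower_bound\<close>). Averaging the Fourier transform of \<open>\<rho> T\<^sub>x g\<close> at a frequency \<open>\<xi>\<close>
  against \<open>e\<^bsup>2 \<pi> i x \<xi>\<^esup>\<close> over all translations \<open>x\<close> gives exactly \<open>N\<close> times the Fourier transform
  of \<open>g\<close> at \<open>\<xi>\<close>. The latter does not vanish identically (\<open>fourier_eq_0_imp_zero\<close>), and by Chebyshev's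
  inequality the average may be restricted to \<open>\<bar>x\<bar> \<le> A\<close> with \<open>A\<close> of order \<open>m\<^bsup>1/2\<^esup>\<close>. Comparing the
  integral over this ball with the \<open>L\<^sup>p\<close> norm gives a bound of order
  \<open>N m\<^bsup>(d/2) (1/p - 1)\<^esup> = m\<^bsup>(d/2) (1 + 1/p)\<^esup>\<close>.

  On the other hand \<open>\<parallel>\<gamma>\<parallel>\<close> in the Schatten class of exponent \<open>r\<close> is \<open>N\<^bsup>1/r\<^esup> = m\<^bsup>d/r\<^esup>\<close>. The ratio is at least of
  order \<open>m\<close> to the power \<open>d ((1 + 1/p) / 2 - 1/r)\<close>, and this exponent is positive exactly when
  \<open>r > 2p / (p + 1)\<close>.\<close>

section \<open>Square-integrable functions and the evolution of eigenfunctions\<close>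

lemma ennreal_powr_ennreal: "0 \<le> a \<Longrightarrow> ennreal_powr (ennreal a) s = ennreal (a powr s)"
  by (simp add: ennreal_powr_def)

lemma ennreal_powr_mono:
  assumes "x \<le> y" "0 \<le> s"
  shows "ennreal_powr x s \<le> ennreal_powr y s"
proof (cases "y = \<infinity>")
  case False
  then obtain b where b: "y = ennreal b" "0 \<le> b" by (cases y) auto
  with assms obtain a where a: "x = ennreal a" "0 \<le> a" by (cases x) (auto simp: top_unique)
  show ?thesis using a b assms
    by (auto simp: ennreal_powr_ennreal intro!: ennreal_leI powr_mono2)
qed (simp add: ennreal_powr_def)

lemma ennreal_powr_powr_inverse:
  assumes "s > 0"
  shows "ennreal_powr (ennreal_powr x s) (1 / s) = x"
proof (cases "x = \<infinity>")
  case False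
  then obtain b where b: "x = ennreal b" "0 \<le> b" by (cases x) auto
  then show ?thesis using assms by (simp add: ennreal_powr_ennreal powr_powr)
qed (simp add: ennreal_powr_def)

lemma measurable_ennreal_powr [measurable]:
  assumes [measurable]: "f \<in> borel_measurable M"
  shows "(\<lambda>x. ennreal_powr (f x) s) \<in> borel_measurable M"
  unfolding ennreal_powr_def by measurable

definition sq_norm :: "('a::euclidean_space \<Rightarrow> complex) \<Rightarrow> ennreal" where
  "sq_norm f = (\<integral>\<^sup>+x. ennreal ((cmod (f x))\<^sup>2) \<partial>lborel)"

lemma L2_norm_eq: "L2_norm f = ennreal_powr (sq_norm f) (1 / 2)"
proof -
  have "ennreal_powr (ennreal (cmod (f x))) 2 = ennreal ((cmod (f x))\<^sup>2)" for x
    by (simp add: ennreal_powr_ennreal)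
  moreover have "(2::ennreal) \<noteq> \<infinity>" by simp
  moreover have "enn2real 2 = 2" by simp
  ultimately show ?thesis unfolding L2_norm_def Lp_norm_def sq_norm_def by simp
qed

lemma sq_norm_eq: "sq_norm f = ennreal_powr (L2_norm f) 2"
  using ennreal_powr_powr_inverse[of "1/2" "sq_norm f"] by (simp add: L2_norm_eq)

lemma L2_iff: "f \<in> L2 \<longleftrightarrow> f \<in> borel_measurable borel \<and> sq_norm f < \<infinity>"
  by (auto simp: L2_def L2_norm_eq ennreal_powr_def less_top[symmetric])

lemma L2_measurable [measurable_dest]: "f \<in> L2 \<Longrightarrow> f \<in> borel_measurable borel"
  by (simp add: L2_iff)

lemma sq_norm_cong_AE:
  assumes "AE x in lborel. f x = h x"
  shows "sq_norm f = sq_norm h"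
  unfolding sq_norm_def by (intro nn_integral_cong_AE) (use assms in auto)

lemma sq_norm_eq_0_iff:
  assumes [measurable]: "f \<in> borel_measurable borel"
  shows "sq_norm f = 0 \<longleftrightarrow> (AE x in lborel. f x = 0)"
  unfolding sq_norm_def by (subst nn_integral_0_iff_AE) auto

lemma sq_norm_cmult:
  assumes [measurable]: "f \<in> borel_measurable borel"
  shows "sq_norm (\<lambda>x. a * f x) = ennreal ((cmod a)\<^sup>2) * sq_norm f"
  unfolding sq_norm_def
  by (subst nn_integral_cmult[symmetric]) (auto simp: norm_mult power_mult_distrib ennreal_mult)

text \<open>Cauchy-Schwarz for finite sums. For squared norms it takes the place of Minkowski's inequality, with the
  same constant when all summands have equal norm.\<close>

lemma sq_norm_sum_le:
  assumes "finite A" and [measurable]: "\<And>i. i \<in> A \<Longrightarrow> f i \<in> borel_measurable borel"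
  shows "sq_norm (\<lambda>x. \<Sum>i\<in>A. f i x) \<le> of_nat (card A) * (\<Sum>i\<in>A. sq_norm (f i))"
proof -
  have "(cmod (\<Sum>i\<in>A. f i x))\<^sup>2 \<le> real (card A) * (\<Sum>i\<in>A. (cmod (f i x))\<^sup>2)" for x
  proof -
    have "(cmod (\<Sum>i\<in>A. f i x))\<^sup>2 \<le> (\<Sum>i\<in>A. cmod (f i x) * 1)\<^sup>2"
      by (intro power_mono) (auto intro: norm_sum)
    also have "\<dots> \<le> (\<Sum>i\<in>A. (cmod (f i x))\<^sup>2) * (\<Sum>i\<in>A. 1\<^sup>2)"
      by (rule Cauchy_Schwarz_ineq_sum)
    finally show ?thesis by (simp add: mult.commute)
  qed
  then have "sq_norm (\<lambda>x. \<Sum>i\<in>A. f i x)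
      \<le> (\<integral>\<^sup>+x. of_nat (card A) * (\<Sum>i\<in>A. ennreal ((cmod (f i x))\<^sup>2)) \<partial>lborel)"
    unfolding sq_norm_def
    by (intro nn_integral_mono) (simp add: ennreal_mult'[symmetric] ennreal_of_nat_eq_real_of_nat sum_nonneg)
  also have "\<dots> = of_nat (card A) * (\<Sum>i\<in>A. sq_norm (f i))"
    using assms unfolding sq_norm_def by (simp add: nn_integral_cmult nn_integral_sum del: sum_ennreal)
  finally show ?thesis .
qed

lemma sq_norm_add_le:
  assumes [measurable]: "f \<in> borel_measurable borel" "h \<in> borel_measurable borel"
  shows "sq_norm (\<lambda>x. f x + h x) \<le> 2 * (sq_norm f + sq_norm h)"
  using sq_norm_sum_le[of "UNIV :: bool set" "\<lambda>b. if b then f else h"] assms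
  by (simp add: UNIV_bool add.commute)

lemma L2_lincomb:
  assumes "f \<in> L2" "h \<in> L2"
  shows "(\<lambda>x. a * f x + b * h x) \<in> L2"
proof -
  note [measurable] = assms[THEN L2_measurable]
  have "sq_norm (\<lambda>x. a * f x + b * h x) \<le> 2 * (sq_norm (\<lambda>x. a * f x) + sq_norm (\<lambda>x. b * h x))"
    by (rule sq_norm_add_le) measurable
  also have "\<dots> < \<infinity>"
    using assms by (simp add: sq_norm_cmult L2_iff ennreal_mult_less_top)
  finally show ?thesis by (simp add: L2_iff)
qed

lemma L2_sum:
  assumes "finite A" "\<And>i. i \<in> A \<Longrightarrow> f i \<in> L2"
  shows "(\<lambda>x. \<Sum>i\<in>A. c i * f i x) \<in> L2"
  using assms
proof (induction rule: finite_induct)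
  case empty
  show ?case by (simp add: L2_iff sq_norm_def)
next
  case (insert i A)
  then show ?case using L2_lincomb[of "f i" "\<lambda>x. \<Sum>i\<in>A. c i * f i x" "c i" 1] by simp
qed

text \<open>The derivative of \<open>cis\<close> at \<open>0\<close>, in the form in which the generator of a unitary group is given.\<close>

lemma cis_difference_quotient:
  "((\<lambda>t. (cis (E * t) - 1) / complex_of_real t - \<i> * complex_of_real E) \<longlongrightarrow> 0) (at 0)"
proof -
  have "((\<lambda>z. exp (\<i> * complex_of_real E * z)) has_field_derivative E *\<^sub>R \<i>) (at (of_real 0))"
    by (auto intro!: derivative_eq_intros simp: scaleR_conv_of_real)
  from has_vector_derivative_real_field[OF this, of UNIV]
  have "((\<lambda>t. cis (E * t)) has_vector_derivative E *\<^sub>R \<i>) (at 0)"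
    by (simp add: cis_conv_exp mult.assoc)
  then have "((\<lambda>t. cmod (cis (E * t) - 1 - t *\<^sub>R (E *\<^sub>R \<i>)) / \<bar>t\<bar>) \<longlongrightarrow> 0) (at 0)"
    by (simp add: has_vector_derivative_def has_derivative_at)
  then have "((\<lambda>t. cmod ((cis (E * t) - 1) / complex_of_real t - \<i> * complex_of_real E)) \<longlongrightarrow> 0) (at 0)"
  proof (rule Lim_transform_eventually)
    show "\<forall>\<^sub>F t in at 0. cmod (cis (E * t) - 1 - t *\<^sub>R (E *\<^sub>R \<i>)) / \<bar>t\<bar>
        = cmod ((cis (E * t) - 1) / complex_of_real t - \<i> * complex_of_real E)"
      unfolding eventually_at_filter
    proof (intro always_eventually allI impI)
      fix t :: real assume "t \<noteq> 0"
      then have "(cis (E * t) - 1) / complex_of_real t - \<i> * complex_of_real E =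
         (cis (E * t) - 1 - t *\<^sub>R (E *\<^sub>R \<i>)) / complex_of_real t"
        by (simp add: field_simps scaleR_conv_of_real)
      then show "cmod (cis (E * t) - 1 - t *\<^sub>R (E *\<^sub>R \<i>)) / \<bar>t\<bar>
        = cmod ((cis (E * t) - 1) / complex_of_real t - \<i> * complex_of_real E)"
        by (simp add: norm_divide)
    qed
  qed
  then show ?thesis by (rule tendsto_norm_zero_cancel)
qed

text \<open>Put \<open>w s = e\<^bsup>-i s E\<^esup> U s f\<close>, so that \<open>w 0 = f\<close> almost everywhere. The defect \<open>D s = \<parallel>w s - f\<parallel>\<^sup>2\<close> is
  \<open>o(s\<^sup>2)\<close>, because \<open>i E f\<close> is the derivative of \<open>U s f\<close> at \<open>s = 0\<close>. By the group law and unitarity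
  all increments \<open>w (t + s) - w t\<close> have the same square norm \<open>D s\<close>. Splitting \<open>[0, t]\<close> into \<open>n\<close> equal
  steps therefore gives \<open>D t \<le> n\<^sup>2 D (t / n)\<close>, which tends to \<open>0\<close> as \<open>n\<close> grows.\<close>

lemma eigenfunction_evolution:
  assumes gen: "generates_unitary_group H U" and f: "schwartz_function f" "f \<in> L2"
    and eig: "\<And>x. H f x = complex_of_real E * f x"
  shows "AE x in lborel. U t f x = cis (E * t) * f x"
proof -
  have ug: "unitary_group U" using gen by (simp add: generates_unitary_group_def)
  have UL2: "U s h \<in> L2" if "h \<in> L2" for s h using ug that by (auto simp: unitary_group_def)
  have Unorm: "sq_norm (U s h) = sq_norm h" if "h \<in> L2" for s h
    using ug that by (auto simp: unitary_group_def sq_norm_eq)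
  have Ulin: "AE x in lborel. U s (\<lambda>y. a * h y + b * k y) x = a * U s h x + b * U s k x"
    if "h \<in> L2" "k \<in> L2" for s h k a b
    using ug that unfolding unitary_group_def by blast
  have U0: "AE x in lborel. U 0 f x = f x" using ug f unfolding unitary_group_def by blast
  have Uadd: "AE x in lborel. U (s + t) f x = U s (U t f) x" for s t
    using ug f unfolding unitary_group_def by blast
  note [measurable] = UL2[OF f(2), THEN L2_measurable] L2_measurable[OF f(2)]
  define w where "w s x = cis (- E * s) * U s f x" for s x
  have [measurable]: "w s \<in> borel_measurable borel" for s unfolding w_def by measurable
  define D where "D s = sq_norm (\<lambda>x. w s x - f x)" for s

  have step: "sq_norm (\<lambda>x. w (t + s) x - w t x) = D s" for s t
  proof -
    define k where "k = (\<lambda>x. cis (- E * s) * U s f x + (-1) * f x)"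
    have k: "k \<in> L2" unfolding k_def by (intro L2_lincomb UL2 f)
    note [measurable] = UL2[OF k, THEN L2_measurable]
    have "AE x in lborel. w (t + s) x - w t x = cis (- E * t) * U t k x"
      using Uadd[of t s] Ulin[OF UL2[OF f(2)] f(2), of t "cis (- E * s)" s "-1"]
      unfolding k_def[symmetric]
    proof eventually_elim
      case (elim x)
      have "cis (- E * (t + s)) = cis (- E * t) * cis (- E * s)"
        by (simp add: cis_mult algebra_simps)
      then have "w (t + s) x - w t x = cis (- E * t) * (cis (- E * s) * U (t + s) f x - U t f x)"
        by (simp only: w_def right_diff_distrib mult.assoc)
      then show ?case using elim by (simp add: add.commute)
    qed
    then have "sq_norm (\<lambda>x. w (t + s) x - w t x) = sq_norm (\<lambda>x. cis (- E * t) * U t k x)"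
      by (rule sq_norm_cong_AE)
    also have "\<dots> = sq_norm (U t k)" by (subst sq_norm_cmult) auto
    also have "\<dots> = sq_norm k" by (rule Unorm[OF k])
    finally show ?thesis by (simp add: D_def k_def w_def)
  qed

  have subdivide: "D t \<le> of_nat n * (of_nat n * D (t / real n))" if "n > 0" for n
  proof -
    define s where "s = t / real n"
    have "AE x in lborel. w t x - f x = (\<Sum>j<n. w (real j * s + s) x - w (real j * s) x)"
      using U0
    proof eventually_elim
      case (elim x)
      have "(\<Sum>j<n. w (real j * s + s) x - w (real j * s) x) = w (real n * s) x - w 0 x"
        using sum_lessThan_telescope[of "\<lambda>j. w (real j * s) x" n]
        by (simp add: algebra_simps)
      then show ?case using elim that by (simp add: s_def w_def)
    qed
    then have "D t = sq_norm (\<lambda>x. \<Sum>j<n. w (real j * s + s) x - w (real j * s) x)"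
      unfolding D_def by (rule sq_norm_cong_AE)
    also have "\<dots> \<le> of_nat n * (\<Sum>j<n. sq_norm (\<lambda>x. w (real j * s + s) x - w (real j * s) x))"
      using sq_norm_sum_le[of "{..<n}" "\<lambda>j x. w (real j * s + s) x - w (real j * s) x"] by simp
    also have "\<dots> = of_nat n * (of_nat n * D s)" by (simp add: step)
    finally show ?thesis by (simp add: s_def)
  qed

  have small: "\<forall>\<^sub>F s in at 0. D s \<le> ennreal (e * s\<^sup>2)" if "e > 0" for e
  proof -
    define S where "S = enn2real (sq_norm f)"
    have S: "sq_norm f = ennreal S" "S \<ge> 0" using f(2) by (auto simp: L2_iff S_def)
    define R where "R s x = (U s f x - f x) / complex_of_real s - \<i> * H f x" for s x
    have [measurable]: "R s \<in> borel_measurable borel" for s unfolding R_def eig by measurable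
    define c where "c s = (cis (E * s) - 1) / complex_of_real s - \<i> * complex_of_real E" for s
    have "((\<lambda>s. L2_norm (R s)) \<longlongrightarrow> 0) (at 0)"
      using gen f unfolding generates_unitary_group_def R_def by blast
    then have "\<forall>\<^sub>F s in at 0. L2_norm (R s) < ennreal (sqrt (e / 4))"
      by (rule order_tendstoD) (use that in auto)
    moreover have "((\<lambda>s. (cmod (c s))\<^sup>2 * S) \<longlongrightarrow> (cmod 0)\<^sup>2 * S) (at 0)"
      unfolding c_def by (intro tendsto_intros cis_difference_quotient)
    then have "\<forall>\<^sub>F s in at 0. (cmod (c s))\<^sup>2 * S < e / 4"
      by (rule order_tendstoD) (use that in auto)
    ultimately show ?thesis using eventually_at_filter[of "\<lambda>s. s \<noteq> 0" 0 UNIV, simplified]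
    proof eventually_elim
      case (elim s)
      have "L2_norm (R s) \<le> ennreal (sqrt (e / 4))" using elim(1) by simp
      from ennreal_powr_mono[OF this, of 2] have R: "sq_norm (R s) \<le> ennreal (e / 4)"
        using that by (simp add: sq_norm_eq ennreal_powr_ennreal)
      have cS: "ennreal ((cmod (c s))\<^sup>2) * sq_norm f \<le> ennreal (e / 4)"
        using elim(2) S by (simp add: ennreal_mult[symmetric] ennreal_leI)
      have "w s x - f x = (cis (- E * s) * s) * (R s x + (- c s) * f x)" for x
      proof -
        have "w s x - f x = cis (- E * s) * (U s f x - cis (E * s) * f x)"
          unfolding w_def right_diff_distrib mult.assoc[symmetric] by (simp add: cis_mult)
        moreover have "s * (R s x + (- c s) * f x) = U s f x - cis (E * s) * f x"
        proof -
          have sR: "s * R s x = U s f x - f x - s * (\<i> * (complex_of_real E * f x))"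
            using elim(3) by (simp add: R_def eig field_simps)
          have sc: "s * c s = cis (E * s) - 1 - s * (\<i> * complex_of_real E)"
            using elim(3) by (simp add: c_def field_simps)
          have "s * (R s x + (- c s) * f x) = s * R s x - (s * c s) * f x"
            by (simp add: algebra_simps)
          also have "\<dots> = U s f x - cis (E * s) * f x"
            unfolding sR sc by (simp add: algebra_simps)
          finally show ?thesis .
        qed
        ultimately show ?thesis by (simp only: mult.assoc)
      qed
      then have "D s = ennreal (s\<^sup>2) * sq_norm (\<lambda>x. R s x + (- c s) * f x)"
        unfolding D_def by (simp only:, subst sq_norm_cmult) (auto simp: norm_mult)
      also have "\<dots> \<le> ennreal (s\<^sup>2) * (2 * (sq_norm (R s) + sq_norm (\<lambda>x. (- c s) * f x)))"
        by (intro mult_left_mono sq_norm_add_le) auto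
      also have "\<dots> \<le> ennreal (s\<^sup>2) * (2 * (ennreal (e / 4) + ennreal (e / 4)))"
      proof -
        have "sq_norm (\<lambda>x. (- c s) * f x) \<le> ennreal (e / 4)"
          using cS by (subst sq_norm_cmult) auto
        with R show ?thesis by (intro mult_left_mono add_mono) auto
      qed
      also have "\<dots> = ennreal (e * s\<^sup>2)"
        using that by (simp add: ennreal_plus[symmetric] ennreal_mult[symmetric] ennreal_numeral[symmetric]
            del: ennreal_plus ennreal_numeral)
      finally show ?case .
    qed
  qed

  have "D t = 0"
  proof (cases "t = 0")
    case True
    have "AE x in lborel. w 0 x - f x = 0" using U0 by eventually_elim (simp add: w_def)
    then show ?thesis using True by (simp add: D_def sq_norm_eq_0_iff)
  next
    case False
    have "D t \<le> 0 + ennreal e" if "e > 0" for e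
    proof -
      have "filterlim (\<lambda>n. t / real n) (at 0) sequentially"
        using False eventually_gt_at_top[of 0]
        by (intro filterlim_atI lim_const_over_n) (auto elim!: eventually_mono)
      from filterlim_iff[THEN iffD1, OF this, rule_format, OF small[of "e / t\<^sup>2"]]
      have "\<forall>\<^sub>F n in sequentially. D (t / real n) \<le> ennreal (e / t\<^sup>2 * (t / real n)\<^sup>2)"
        using that False by simp
      then obtain n where n: "n > 0" "D (t / real n) \<le> ennreal (e / t\<^sup>2 * (t / real n)\<^sup>2)"
        using eventually_happens'[OF sequentially_bot eventually_conj[OF eventually_gt_at_top[of 0]]]
        by blast
      have "D t \<le> of_nat n * (of_nat n * ennreal (e / t\<^sup>2 * (t / real n)\<^sup>2))"
        using subdivide[OF n(1)] n(2) by (meson mult_left_mono order_trans zero_le)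
      also have "\<dots> = ennreal e"
        using n False that
        by (simp add: ennreal_of_nat_eq_real_of_nat ennreal_mult'[symmetric] power_divide power2_eq_square)
      finally show ?thesis by simp
    qed
    then have "D t \<le> 0" by (rule ennreal_le_epsilon)
    then show ?thesis by simp
  qed
  then have "AE x in lborel. w t x - f x = 0" unfolding D_def by (subst (asm) sq_norm_eq_0_iff) auto
  then show ?thesis
  proof eventually_elim
    case (elim x)
    have "cis (E * t) * w t x = U t f x"
      unfolding w_def mult.assoc[symmetric] by (simp add: cis_mult)
    then show ?case using elim by simp
  qed
qed

section \<open>Lower bounds for Lebesgue norms\<close>

text \<open>A substitute for Hoelder's inequality that only loses a factor \<open>2\<close>: for every threshold
  \<open>\<theta> > 0\<close> one has \<open>G \<le> \<theta> + \<theta>\<^bsup>1 - a\<^esup> G\<^sup>a\<close> pointwise (distinguish \<open>G \<le> \<theta>\<close> and \<open>G > \<theta>\<close>). With \<open>\<theta>\<close> half of the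
  average of \<open>G\<close> over \<open>B\<close>, the first term accounts for at most half of the integral.\<close>

lemma nn_integral_power_lower_bound:
  fixes G :: "'a \<Rightarrow> ennreal"
  assumes [measurable]: "B \<in> sets M" "G \<in> borel_measurable M"
    and V: "emeasure M B = ennreal V" "V > 0" and a: "a \<ge> 1"
    and le: "ennreal A \<le> (\<integral>\<^sup>+x. G x * indicator B x \<partial>M)" and A: "A > 0"
  shows "ennreal ((A / 2) * (A / (2 * V)) powr (a - 1)) \<le> (\<integral>\<^sup>+x. ennreal_powr (G x) a \<partial>M)"
proof -
  define \<theta> where "\<theta> = A / (2 * V)"
  have \<theta>: "\<theta> > 0" using A V by (simp add: \<theta>_def)
  have split: "G x \<le> ennreal \<theta> + ennreal (\<theta> powr (1 - a)) * ennreal_powr (G x) a" for x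
  proof (cases "G x = \<infinity>")
    case True
    then show ?thesis using \<theta> by (simp add: ennreal_powr_def ennreal_mult_eq_top_iff)
  next
    case False
    then obtain y where y: "G x = ennreal y" "y \<ge> 0" by (cases "G x") auto
    have "y \<le> \<theta> + \<theta> powr (1 - a) * y powr a"
    proof (cases "y \<le> \<theta>")
      case True
      then show ?thesis using \<theta> by (simp add: add_increasing2)
    next
      case False
      then have y0: "y > 0" using \<theta> by simp
      have "1 \<le> (y / \<theta>) powr (a - 1)" using False \<theta> a by (intro ge_one_powr_ge_zero) auto
      then have "y * 1 \<le> y * (y / \<theta>) powr (a - 1)" using y by (intro mult_left_mono) auto
      also have "\<dots> = \<theta> powr (1 - a) * y powr a"
        using y0 \<theta> by (simp add: powr_divide powr_diff field_simps)
      finally show ?thesis using \<theta> by simp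
    qed
    then show ?thesis using y \<theta>
      by (simp add: ennreal_powr_ennreal ennreal_mult[symmetric] ennreal_plus[symmetric] del: ennreal_plus)
  qed
  have "ennreal A \<le> (\<integral>\<^sup>+x. G x * indicator B x \<partial>M)" by (rule le)
  also have "\<dots> \<le> (\<integral>\<^sup>+x. ennreal \<theta> * indicator B x + ennreal (\<theta> powr (1 - a)) * ennreal_powr (G x) a \<partial>M)"
    using split by (intro nn_integral_mono) (auto simp: indicator_def)
  also have "\<dots> = ennreal (A / 2) + ennreal (\<theta> powr (1 - a)) * (\<integral>\<^sup>+x. ennreal_powr (G x) a \<partial>M)"
    using V \<theta> by (simp add: nn_integral_add nn_integral_cmult ennreal_mult[symmetric] \<theta>_def)
  finally have *: "ennreal A \<le> ennreal (A / 2) + ennreal (\<theta> powr (1 - a)) * (\<integral>\<^sup>+x. ennreal_powr (G x) a \<partial>M)" .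
  show ?thesis
  proof (cases "(\<integral>\<^sup>+x. ennreal_powr (G x) a \<partial>M) = \<infinity>")
    case False
    then obtain z where z: "(\<integral>\<^sup>+x. ennreal_powr (G x) a \<partial>M) = ennreal z" "z \<ge> 0"
      by (cases "\<integral>\<^sup>+x. ennreal_powr (G x) a \<partial>M") auto
    with * have "A \<le> A / 2 + \<theta> powr (1 - a) * z"
      using A by (simp add: ennreal_mult[symmetric] ennreal_plus[symmetric] del: ennreal_plus)
    then have "A / 2 \<le> z / \<theta> powr (a - 1)"
      using \<theta> by (simp add: powr_diff field_simps)
    then have "A / 2 * \<theta> powr (a - 1) \<le> z" using \<theta> by (simp add: field_simps)
    then show ?thesis using z by (simp add: \<theta>_def ennreal_leI)
  qed simp
qed

text \<open>The previous bound raised to the power \<open>1 / a\<close>. At \<open>a = \<infinity>\<close>, the essential supremum is at least the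
  average over \<open>B\<close>.\<close>

lemma Lp_norm_lower_bound:
  fixes G :: "'a \<Rightarrow> ennreal"
  assumes [measurable]: "B \<in> sets M" "G \<in> borel_measurable M"
    and V: "emeasure M B = ennreal V" "V > 0" and a: "a \<ge> 1"
    and le: "ennreal A \<le> (\<integral>\<^sup>+x. G x * indicator B x \<partial>M)" and A: "A \<ge> 0"
  shows "ennreal (A / 2 * V powr (enn2real (inverse a) - 1)) \<le> Lp_norm a M G"
proof (cases "A = 0")
  case False
  with A have A: "A > 0" by simp
  show ?thesis
  proof (cases "a = \<infinity>")
    case True
    have "ennreal (A / V) \<le> c" if c: "AE x in M. G x \<le> c" for c
    proof (cases "c = \<infinity>")
      case False
      then obtain y where y: "c = ennreal y" "y \<ge> 0" by (cases c) auto
      have "ennreal A \<le> (\<integral>\<^sup>+x. c * indicator B x \<partial>M)"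
        by (rule order_trans[OF le], intro nn_integral_mono_AE, use c in eventually_elim)
          (auto simp: indicator_def)
      also have "\<dots> = c * emeasure M B" by (simp add: nn_integral_cmult_indicator)
      also have "\<dots> = ennreal (y * V)" using y V by (simp add: ennreal_mult)
      finally show ?thesis using y V A by (simp add: field_simps ennreal_leI)
    qed simp
    then have "ennreal (A / V) \<le> Lp_norm a M G"
      unfolding Lp_norm_def using True by (auto intro: Inf_greatest)
    moreover have "A / 2 * V powr (enn2real (inverse a) - 1) \<le> A / V"
      using True V A by (simp add: powr_minus_divide field_simps)
    ultimately show ?thesis by (meson ennreal_leI order_trans)
  next
    case False
    define b where "b = enn2real a"
    have ab: "a = ennreal b" "b \<ge> 1"
      using False a unfolding b_def by (cases a; simp)+
    have "ennreal (A / 2 * V powr (1 / b - 1)) \<le> ennreal (((A / 2) * (A / (2 * V)) powr (b - 1)) powr (1 / b))"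
    proof (rule ennreal_leI)
      have "((A / 2) * (A / (2 * V)) powr (b - 1)) = (A / 2) powr b * V powr (1 - b)"
        using A V by (simp add: powr_divide powr_diff powr_mult field_simps)
      then have "((A / 2) * (A / (2 * V)) powr (b - 1)) powr (1 / b)
          = ((A / 2) powr b) powr (1 / b) * (V powr (1 - b)) powr (1 / b)"
        using A V by (simp add: powr_mult)
      also have "\<dots> = A / 2 * V powr (1 / b - 1)"
        using A V ab by (simp add: powr_powr diff_divide_distrib)
      finally show "A / 2 * V powr (1 / b - 1) \<le> ((A / 2) * (A / (2 * V)) powr (b - 1)) powr (1 / b)"
        by simp
    qed
    also have "\<dots> = ennreal_powr (ennreal ((A / 2) * (A / (2 * V)) powr (b - 1))) (1 / b)"
      using A by (simp add: ennreal_powr_ennreal)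
    also have "\<dots> \<le> ennreal_powr (\<integral>\<^sup>+x. ennreal_powr (G x) b \<partial>M) (1 / b)"
      using ab by (intro ennreal_powr_mono nn_integral_power_lower_bound[OF assms(1-4) _ le A]) auto
    also have "\<dots> = Lp_norm a M G"
      using False by (simp add: Lp_norm_def b_def)
    finally show ?thesis using ab by (simp add: inverse_ennreal inverse_eq_divide)
  qed
qed simp

text \<open>The same bound when the integral over \<open>B\<close> may be infinite.\<close>

lemma Lp_norm_ge_integral:
  fixes G :: "'a \<Rightarrow> ennreal"
  assumes "B \<in> sets M" "G \<in> borel_measurable M"
    and "emeasure M B = ennreal V" "V > 0" and "a \<ge> 1"
  shows "ennreal (V powr (enn2real (inverse a) - 1) / 2) * (\<integral>\<^sup>+x. G x * indicator B x \<partial>M) \<le> Lp_norm a M G"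
    (is "ennreal ?k * ?J \<le> _")
proof (cases "?J = \<infinity>")
  case False
  then obtain A where A: "?J = ennreal A" "A \<ge> 0" by (cases ?J) auto
  then have "ennreal ?k * ?J = ennreal (A / 2 * V powr (enn2real (inverse a) - 1))"
    using assms(4) by (simp add: ennreal_mult[symmetric] mult.commute)
  also have "\<dots> \<le> Lp_norm a M G"
    by (rule Lp_norm_lower_bound[OF assms]) (use A in auto)
  finally show ?thesis .
next
  case True
  have large: "ennreal x \<le> Lp_norm a M G" if "x > 0" for x
  proof -
    have k: "?k > 0" using assms(4) by simp
    have "ennreal ((x / ?k) / 2 * V powr (enn2real (inverse a) - 1)) \<le> Lp_norm a M G"
      by (rule Lp_norm_lower_bound[OF assms]) (use True that k in auto)
    then show ?thesis using assms(4) by simp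
  qed
  have "Lp_norm a M G = \<infinity>"
  proof (rule ccontr)
    assume "Lp_norm a M G \<noteq> \<infinity>"
    then obtain l where "Lp_norm a M G = ennreal l" "l \<ge> 0" by (cases "Lp_norm a M G") auto
    with large[of "l + 1"] show False by simp
  qed
  then show ?thesis by simp
qed

lemma Lp_norm_mono:
  assumes "\<And>x. F x \<le> G x"
  shows "Lp_norm a M F \<le> Lp_norm a M G"
proof (cases "a = \<infinity>")
  case True
  have "AE x in M. F x \<le> c" if "AE x in M. G x \<le> c" for c
    using that by eventually_elim (use assms order_trans in blast)
  then show ?thesis using True unfolding Lp_norm_def by (simp, intro Inf_superset_mono) blast
next
  case False
  then show ?thesis unfolding Lp_norm_def
    by (auto intro!: ennreal_powr_mono nn_integral_mono assms)
qed

text \<open>On a measure space of mass at least \<open>1\<close>, a stationary quantity is not made smaller by taking its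
  norm in time. The length \<open>\<pi> / 2\<close> of the time interval exceeds \<open>1\<close>.\<close>

lemma Lp_norm_const_ge:
  assumes "1 \<le> emeasure M (space M)" and "q > 0"
  shows "W \<le> Lp_norm q M (\<lambda>_. W)"
proof (cases "q = \<infinity>")
  case True
  have "W \<le> c" if "AE x in M. W \<le> c" for c
  proof (rule ccontr)
    assume "\<not> W \<le> c"
    then have "AE x in M. False" using that by simp
    then obtain N where N: "space M \<subseteq> N" "emeasure M N = 0" "N \<in> sets M"
      by (auto elim: AE_E)
    then have "emeasure M (space M) = 0" using emeasure_mono[of "space M" N M] by simp
    then show False using assms by simp
  qed
  then show ?thesis using True unfolding Lp_norm_def by (auto intro: Inf_greatest)
next
  case False
  then have b: "enn2real q > 0" using assms by (simp add: enn2real_positive_iff less_top)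
  have "ennreal_powr W (enn2real q) * 1 \<le> ennreal_powr W (enn2real q) * emeasure M (space M)"
    using assms by (intro mult_left_mono) auto
  from ennreal_powr_mono[OF this, of "1 / enn2real q"] show ?thesis
    using b False ennreal_powr_powr_inverse[OF b, of W] by (simp add: Lp_norm_def)
qed

section \<open>Injectivity of the Fourier transform\<close>

text \<open>The frequencies \<open>\<xi>\<close> are arbitrary, not restricted to a lattice: such functions
  separate all points of the space.\<close>

inductive trig_poly :: "('a::euclidean_space \<Rightarrow> complex) \<Rightarrow> bool" where
  monomial: "trig_poly (\<lambda>y. c * cis (- 2 * pi * (y \<bullet> \<xi>)))"
| add: "trig_poly u \<Longrightarrow> trig_poly v \<Longrightarrow> trig_poly (\<lambda>y. u y + v y)"

lemma trig_poly_const: "trig_poly (\<lambda>_. c)"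
  using trig_poly.monomial[of c 0] by simp

lemma trig_poly_mult_monomial:
  "trig_poly v \<Longrightarrow> trig_poly (\<lambda>y. c * cis (- 2 * pi * (y \<bullet> \<xi>)) * v y)"
proof (induction rule: trig_poly.induct)
  case (monomial c' \<xi>')
  have "c * p * (c' * q) = (c * c') * (p * q)" for p q :: complex
    by (simp add: mult_ac)
  then have "(\<lambda>y. c * cis (- 2 * pi * (y \<bullet> \<xi>)) * (c' * cis (- 2 * pi * (y \<bullet> \<xi>'))))
      = (\<lambda>y. (c * c') * cis (- 2 * pi * (y \<bullet> (\<xi> + \<xi>'))))"
    by (simp only: cis_mult inner_add_right distrib_left)
  then show ?case using trig_poly.monomial[of "c * c'" "\<xi> + \<xi>'"] by simp
next
  case (add u v)
  then show ?case using trig_poly.add by (simp add: distrib_left)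
qed

lemma trig_poly_mult: "trig_poly u \<Longrightarrow> trig_poly v \<Longrightarrow> trig_poly (\<lambda>y. u y * v y)"
proof (induction rule: trig_poly.induct)
  case (monomial c \<xi>)
  then show ?case by (rule trig_poly_mult_monomial)
next
  case (add u w)
  then show ?case using trig_poly.add by (simp add: distrib_right)
qed

lemma trig_poly_continuous: "trig_poly u \<Longrightarrow> continuous_on S u"
  by (induction rule: trig_poly.induct) (auto intro!: continuous_intros)

lemma trig_poly_bounded: "trig_poly u \<Longrightarrow> \<exists>B. \<forall>y. cmod (u y) \<le> B"
proof (induction rule: trig_poly.induct)
  case (monomial c \<xi>)
  show ?case by (auto simp: norm_mult)
next
  case (add u v)
  then obtain B C where "\<And>y. cmod (u y) \<le> B" "\<And>y. cmod (v y) \<le> C" by blast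
  then show ?case by (intro exI[of _ "B + C"]) (meson add_mono norm_triangle_ineq order_trans)
qed

lemma trig_poly_integrable:
  assumes "integrable lborel g" "trig_poly u"
  shows "integrable lborel (\<lambda>y. u y * g y)"
proof -
  obtain B where B: "\<And>y. cmod (u y) \<le> B" using trig_poly_bounded[OF assms(2)] by blast
  have [measurable]: "u \<in> borel_measurable borel"
    by (intro borel_measurable_continuous_onI trig_poly_continuous assms)
  have "integrable lborel (\<lambda>y. B * norm (g y))" using assms by auto
  then show ?thesis
    by (rule Bochner_Integration.integrable_bound)
      (use assms B in \<open>auto simp: norm_mult intro!: mult_right_mono order_trans[OF _ abs_ge_self]\<close>)
qed

lemma trig_poly_integral_eq_0:
  assumes g: "integrable lborel g" and "\<And>\<xi>. fourier g \<xi> = 0"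
  shows "trig_poly u \<Longrightarrow> (\<integral>y. u y * g y \<partial>lborel) = 0"
proof (induction rule: trig_poly.induct)
  case (monomial c \<xi>)
  then show ?case using assms(2)[of \<xi>] by (simp add: fourier_def mult.assoc)
next
  case (add u v)
  then show ?case by (simp add: distrib_right trig_poly_integrable[OF g])
qed

text \<open>With \<open>\<xi>\<close> parallel to \<open>x - y\<close> and suitably scaled, the phases at \<open>x\<close> and \<open>y\<close> differ by \<open>\<pi>\<close>. Hence both
  cosine and sine change sign between the two points, and one of them does not vanish there.\<close>

lemma trig_poly_separates:
  fixes x y :: "'a::euclidean_space"
  assumes "x \<noteq> y"
  shows "\<exists>f::'a \<Rightarrow> real. trig_poly (\<lambda>z. complex_of_real (f z)) \<and> f x \<noteq> f y"
proof -
  define n where "n = norm (x - y)"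
  have n: "n > 0" using assms by (simp add: n_def)
  define \<xi> where "\<xi> = (1 / (2 * n\<^sup>2)) *\<^sub>R (x - y)"
  define a where "a z = 2 * pi * (z \<bullet> \<xi>)" for z
  have "(x - y) \<bullet> \<xi> = 1 / 2"
    using n by (simp add: \<xi>_def n_def dot_square_norm)
  then have "a x = a y + pi" by (simp add: a_def inner_diff_left algebra_simps)
  then have sep: "cos (a x) = - cos (a y)" "sin (a x) = - sin (a y)" by simp_all
  have cos: "trig_poly (\<lambda>z. complex_of_real (cos (a z)))"
  proof -
    have "(\<lambda>z. complex_of_real (cos (a z)))
        = (\<lambda>z. 1 / 2 * cis (- 2 * pi * (z \<bullet> \<xi>)) + 1 / 2 * cis (- 2 * pi * (z \<bullet> (- \<xi>))))"
      by (auto simp: fun_eq_iff complex_eq_iff a_def)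
    then show ?thesis by (simp only:) (intro trig_poly.intros)
  qed
  have sin: "trig_poly (\<lambda>z. complex_of_real (sin (a z)))"
  proof -
    have "(\<lambda>z. complex_of_real (sin (a z)))
        = (\<lambda>z. \<i> / 2 * cis (- 2 * pi * (z \<bullet> \<xi>)) + (- \<i> / 2) * cis (- 2 * pi * (z \<bullet> (- \<xi>))))"
      by (auto simp: fun_eq_iff complex_eq_iff a_def)
    then show ?thesis by (simp only:) (intro trig_poly.intros)
  qed
  have "cos (a y) \<noteq> 0 \<or> sin (a y) \<noteq> 0" using sin_cos_squared_add[of "a y"] by force
  then show ?thesis
  proof
    assume "cos (a y) \<noteq> 0"
    then show ?thesis using sep cos by (intro exI[of _ "\<lambda>z. cos (a z)"]) auto
  next
    assume "sin (a y) \<noteq> 0"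
    then show ?thesis using sep sin by (intro exI[of _ "\<lambda>z. sin (a z)"]) auto
  qed
qed

lemma continuous_AE_zero_imp_zero:
  fixes u :: "'a::euclidean_space \<Rightarrow> real"
  assumes "continuous_on UNIV u" "AE x in lborel. u x = 0"
  shows "u = (\<lambda>_. 0)"
proof -
  have "open {x. u x \<noteq> 0}" using assms(1) by (intro open_Collect_neq) auto
  moreover have "{x. u x \<noteq> 0} \<in> null_sets lborel"
    using assms calculation by (subst (asm) AE_iff_null) auto
  then have "negligible {x. u x \<noteq> 0}"
    by (simp add: negligible_iff_null_sets null_sets_completionI)
  ultimately show ?thesis using open_not_negligible by auto
qed

text \<open>By Stone-Weierstrass, \<open>u\<close> is on its support a uniform limit of trigonometric polynomials. So \<open>u\<close> is
  orthogonal to itself.\<close>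

lemma orthogonal_to_trig_polys_imp_zero:
  fixes u :: "'a::euclidean_space \<Rightarrow> real"
  assumes u: "continuous_on UNIV u" and K: "compact K" "\<And>x. x \<notin> K \<Longrightarrow> u x = 0"
    and orth: "\<And>q. trig_poly (\<lambda>y. complex_of_real (q y)) \<Longrightarrow> (\<integral>y. q y * u y \<partial>lborel) = 0"
  shows "u = (\<lambda>_. 0)"
proof -
  have int: "integrable lborel (\<lambda>y. w y * u y)" if "continuous_on UNIV w" for w
  proof -
    have "integrable lborel (\<lambda>x. indicator K x *\<^sub>R (w x * u x))"
      by (intro borel_integrable_compact K continuous_intros continuous_on_subset[OF u] continuous_on_subset[OF that]) auto
    then show ?thesis by (rule Bochner_Integration.integrable_cong[THEN iffD1, rotated 2])
      (auto simp: indicator_def K)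
  qed
  have intu: "integrable lborel u" using int[of "\<lambda>_. 1"] by simp
  have cont: "continuous_on UNIV q" if "trig_poly (\<lambda>y. complex_of_real (q y))" for q
    using continuous_on_Re[OF trig_poly_continuous[OF that]] by simp
  have "(\<integral>y. u y * u y \<partial>lborel) \<le> 0"
  proof (rule field_le_epsilon)
    fix e :: real assume "e > 0"
    define L where "L = (\<integral>y. \<bar>u y\<bar> \<partial>lborel)"
    have L: "L \<ge> 0" by (simp add: L_def)
    define e' where "e' = e / (L + 1)"
    have e': "e' > 0" "e' * L \<le> e" using \<open>e > 0\<close> L by (auto simp: e'_def field_simps)
    have "\<exists>q. trig_poly (\<lambda>y. complex_of_real (q y)) \<and> (\<forall>x\<in>K. \<bar>u x - q x\<bar> < e')"
    proof (rule Stone_Weierstrass_HOL[OF K(1)])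
      show "trig_poly (\<lambda>y. complex_of_real (f y + g y))"
        if "trig_poly (\<lambda>y. complex_of_real (f y)) \<and> trig_poly (\<lambda>y. complex_of_real (g y))" for f g
        using trig_poly.add[OF that[THEN conjunct1] that[THEN conjunct2]] by simp
      show "trig_poly (\<lambda>y. complex_of_real (f y * g y))"
        if "trig_poly (\<lambda>y. complex_of_real (f y)) \<and> trig_poly (\<lambda>y. complex_of_real (g y))" for f g
        using trig_poly_mult[OF that[THEN conjunct1] that[THEN conjunct2]] by simp
    qed (use u e' in \<open>auto intro: trig_poly_const trig_poly_separates continuous_on_subset[OF cont] continuous_on_subset[OF u]\<close>)
    then obtain q where q: "trig_poly (\<lambda>y. complex_of_real (q y))" "\<And>x. x \<in> K \<Longrightarrow> \<bar>u x - q x\<bar> < e'"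
      by blast
    have "(\<integral>y. u y * u y \<partial>lborel) = (\<integral>y. u y * u y - q y * u y \<partial>lborel)"
      using orth[OF q(1)] int[OF u] int[OF cont[OF q(1)]] by simp
    also have "\<dots> \<le> (\<integral>y. e' * \<bar>u y\<bar> \<partial>lborel)"
    proof (rule integral_mono)
      show "u y * u y - q y * u y \<le> e' * \<bar>u y\<bar>" for y
      proof (cases "y \<in> K")
        case True
        have "u y * u y - q y * u y \<le> \<bar>(u y - q y) * u y\<bar>" by (simp add: algebra_simps)
        also have "\<dots> \<le> e' * \<bar>u y\<bar>" using q(2)[OF True] by (auto simp: abs_mult intro!: mult_right_mono)
        finally show ?thesis .
      qed (simp add: K)
    qed (use int[OF u] int[OF cont[OF q(1)]] intu in auto)
    also have "\<dots> \<le> e" using e' by (simp add: L_def)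
    finally show "(\<integral>y. u y * u y \<partial>lborel) \<le> 0 + e" by simp
  qed
  moreover have "(\<integral>y. u y * u y \<partial>lborel) \<ge> 0" by simp
  ultimately have "(\<integral>y. u y * u y \<partial>lborel) = 0" by linarith
  then have "AE y in lborel. u y * u y = 0"
    using integral_nonneg_eq_0_iff_AE[OF int[OF u]] by simp
  then have "AE y in lborel. u y = 0" by simp
  then show ?thesis by (rule continuous_AE_zero_imp_zero[OF u])
qed

text \<open>The vanishing of \<open>fourier g\<close> says that \<open>g\<close> is orthogonal to all trigonometric monomials. Real trigonometric
  polynomials then also annihilate the real and the imaginary part of \<open>g\<close> separately.\<close>

lemma fourier_eq_0_imp_zero:
  fixes g :: "'a::euclidean_space \<Rightarrow> complex"
  assumes g: "continuous_on UNIV g" "integrable lborel g" and K: "compact K" "\<And>x. x \<notin> K \<Longrightarrow> g x = 0"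
    and zero: "\<And>\<xi>. fourier g \<xi> = 0"
  shows "g = (\<lambda>_. 0)"
proof -
  have orth: "(\<integral>y. complex_of_real (q y) * g y \<partial>lborel) = 0"
    "integrable lborel (\<lambda>y. complex_of_real (q y) * g y)"
    if "trig_poly (\<lambda>y. complex_of_real (q y))" for q
    using trig_poly_integral_eq_0[OF g(2) zero that] trig_poly_integrable[OF g(2) that] by auto
  have "(\<lambda>x. Re (g x)) = (\<lambda>_. 0)"
    using integral_Re[OF orth(2)] orth(1)
    by (intro orthogonal_to_trig_polys_imp_zero[OF _ K(1)]) (auto simp: K intro!: continuous_intros g)
  moreover have "(\<lambda>x. Im (g x)) = (\<lambda>_. 0)"
    using integral_Im[OF orth(2)] orth(1)
    by (intro orthogonal_to_trig_polys_imp_zero[OF _ K(1)]) (auto simp: K intro!: continuous_intros g)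
  ultimately show ?thesis by (auto simp: fun_eq_iff complex_eq_iff)
qed

section \<open>Amalgam norms of nonnegative functions are bounded below by their mass\<close>

lemma measurable_cis [measurable]: "cis \<in> borel_measurable borel"
  by (intro borel_measurable_continuous_onI) (auto simp: cis_conv_exp intro!: continuous_intros)

lemma lborel_distr_reflect:
  fixes y :: "'a::euclidean_space"
  shows "distr lborel borel (\<lambda>x. y - x) = lborel"
  by (subst (2) lborel_affine[of "-1" y]) (auto simp: density_1)

lemma nn_integral_reflect:
  fixes y :: "'a::euclidean_space"
  assumes [measurable]: "f \<in> borel_measurable borel"
  shows "(\<integral>\<^sup>+x. f (y - x) \<partial>lborel) = (\<integral>\<^sup>+x. f x \<partial>lborel)"
  by (subst (2) lborel_distr_reflect[of y, symmetric]) (simp add: nn_integral_distr)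

lemma integral_reflect:
  fixes y :: "'a::euclidean_space" and f :: "'a \<Rightarrow> complex"
  assumes [measurable]: "f \<in> borel_measurable borel"
  shows "(\<integral>x. f (y - x) \<partial>lborel) = (\<integral>x. f x \<partial>lborel)"
  by (subst (2) lborel_distr_reflect[of y, symmetric]) (simp add: integral_distr)

lemma isCont_fourier:
  assumes g: "integrable lborel g"
  shows "isCont (fourier g) \<xi>"
  unfolding continuous_at_sequentially comp_def fourier_def
proof (intro allI impI)
  fix X :: "nat \<Rightarrow> 'a" assume X: "X \<longlonglongrightarrow> \<xi>"
  note [measurable] = borel_measurable_integrable[OF g]
  show "(\<lambda>n. \<integral>y. cis (- 2 * pi * (y \<bullet> X n)) * g y \<partial>lborel)
      \<longlonglongrightarrow> (\<integral>y. cis (- 2 * pi * (y \<bullet> \<xi>)) * g y \<partial>lborel)"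
    by (rule integral_dominated_convergence[where w = "\<lambda>y. norm (g y)"])
      (use g X in \<open>auto simp: norm_mult cis_conv_exp intro!: tendsto_intros\<close>)
qed

context
  fixes g :: "'a::euclidean_space \<Rightarrow> complex" and \<rho> :: "'a \<Rightarrow> real"
  assumes g [measurable]: "integrable lborel g" and \<rho> [measurable]: "integrable lborel \<rho>"
    and \<rho>_nonneg: "\<And>y. 0 \<le> \<rho> y"
begin

lemma localized_fourier_measurable:
  "(\<lambda>(x, \<xi>). fourier (\<lambda>y. complex_of_real (\<rho> y) * translate x g y) \<xi>)
     \<in> borel_measurable (lborel \<Otimes>\<^sub>M lborel)"
  unfolding fourier_def translate_def by measurable

text \<open>By Fubini, \<open>\<integral> e\<^bsup>2 \<pi> i x \<xi>\<^esup> F(\<rho> T\<^sub>x g)(\<xi>) dx = (\<integral> \<rho>) F g(\<xi>)\<close>, where \<open>F\<close> is the Fourier transform and \<open>T\<^sub>x\<close>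
  the translation: substitute \<open>y - x\<close> for \<open>x\<close> in the inner integral.\<close>

lemma mass_times_fourier_le:
  "ennreal ((\<integral>y. \<rho> y \<partial>lborel) * cmod (fourier g \<xi>))
     \<le> (\<integral>\<^sup>+x. ennreal (cmod (fourier (\<lambda>y. complex_of_real (\<rho> y) * translate x g y) \<xi>)) \<partial>lborel)"
proof -
  define F where "F x = fourier (\<lambda>y. complex_of_real (\<rho> y) * translate x g y) \<xi>" for x
  define h where "h x y = cis (2 * pi * (x \<bullet> \<xi>)) * (cis (- 2 * pi * (y \<bullet> \<xi>)) * (complex_of_real (\<rho> y) * g (y - x)))" for x y
  have h_meas [measurable]: "(\<lambda>(x, y). h x y) \<in> borel_measurable (lborel \<Otimes>\<^sub>M lborel)"
    unfolding h_def by measurable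
  have "(\<integral>\<^sup>+z. norm (case z of (x, y) \<Rightarrow> h x y) \<partial>(lborel \<Otimes>\<^sub>M lborel))
      = (\<integral>\<^sup>+y. \<integral>\<^sup>+x. norm (h x y) \<partial>lborel \<partial>lborel)"
    by (subst lborel_pair.nn_integral_snd[symmetric]) auto
  also have "\<dots> = (\<integral>\<^sup>+y. ennreal (\<rho> y) * (\<integral>\<^sup>+x. norm (g x) \<partial>lborel) \<partial>lborel)"
  proof (intro nn_integral_cong)
    fix y
    have "(\<integral>\<^sup>+x. norm (h x y) \<partial>lborel) = (\<integral>\<^sup>+x. ennreal (\<rho> y) * norm (g (y - x)) \<partial>lborel)"
      using \<rho>_nonneg by (simp add: h_def norm_mult ennreal_mult)
    also have "\<dots> = ennreal (\<rho> y) * (\<integral>\<^sup>+x. norm (g (y - x)) \<partial>lborel)"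
      by (rule nn_integral_cmult) measurable
    also have "(\<integral>\<^sup>+x. norm (g (y - x)) \<partial>lborel) = (\<integral>\<^sup>+x. norm (g x) \<partial>lborel)"
      by (rule nn_integral_reflect) measurable
    finally show "(\<integral>\<^sup>+x. norm (h x y) \<partial>lborel) = ennreal (\<rho> y) * (\<integral>\<^sup>+x. norm (g x) \<partial>lborel)" .
  qed
  also have "\<dots> = (\<integral>\<^sup>+y. norm (\<rho> y) \<partial>lborel) * (\<integral>\<^sup>+x. norm (g x) \<partial>lborel)"
    using \<rho>_nonneg by (simp add: nn_integral_multc)
  also have "\<dots> < \<infinity>"
    using g \<rho> by (simp add: integrable_iff_bounded ennreal_mult_less_top)
  finally have h: "integrable (lborel \<Otimes>\<^sub>M lborel) (\<lambda>(x, y). h x y)"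
    by (intro integrableI_bounded) auto
  have hx: "(\<integral>y. h x y \<partial>lborel) = cis (2 * pi * (x \<bullet> \<xi>)) * F x" for x
    by (simp add: h_def F_def fourier_def translate_def)
  have hy: "(\<integral>x. h x y \<partial>lborel) = complex_of_real (\<rho> y) * fourier g \<xi>" for y
  proof -
    have "h x y = complex_of_real (\<rho> y) * (cis (- 2 * pi * ((y - x) \<bullet> \<xi>)) * g (y - x))" for x
    proof -
      have eq: "cis (- 2 * pi * ((y - x) \<bullet> \<xi>)) = cis (2 * pi * (x \<bullet> \<xi>)) * cis (- 2 * pi * (y \<bullet> \<xi>))"
        by (simp add: cis_mult inner_diff_left algebra_simps)
      show ?thesis unfolding h_def eq by (simp only: mult_ac)
    qed
    then have "(\<integral>x. h x y \<partial>lborel)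
        = complex_of_real (\<rho> y) * (\<integral>x. cis (- 2 * pi * ((y - x) \<bullet> \<xi>)) * g (y - x) \<partial>lborel)"
      by simp
    also have "(\<integral>x. cis (- 2 * pi * ((y - x) \<bullet> \<xi>)) * g (y - x) \<partial>lborel)
        = (\<integral>x. cis (- 2 * pi * (x \<bullet> \<xi>)) * g x \<partial>lborel)"
      by (rule integral_reflect) measurable
    finally show ?thesis by (simp add: fourier_def)
  qed
  have "(\<integral>x. cis (2 * pi * (x \<bullet> \<xi>)) * F x \<partial>lborel) = (\<integral>y. complex_of_real (\<rho> y) * fourier g \<xi> \<partial>lborel)"
    using lborel_pair.Fubini_integral[OF h] by (simp add: hx hy)
  also have "\<dots> = complex_of_real (\<integral>y. \<rho> y \<partial>lborel) * fourier g \<xi>" by simp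
  finally have eq: "(\<integral>x. cis (2 * pi * (x \<bullet> \<xi>)) * F x \<partial>lborel) = complex_of_real (\<integral>y. \<rho> y \<partial>lborel) * fourier g \<xi>" .
  have "integrable lborel (\<lambda>x. cis (2 * pi * (x \<bullet> \<xi>)) * F x)"
    using lborel_pair.integrable_fst[OF h] by (simp add: hx)
  from integral_norm_bound_ennreal[OF this]
  have "ennreal (cmod (complex_of_real (\<integral>y. \<rho> y \<partial>lborel) * fourier g \<xi>)) \<le> (\<integral>\<^sup>+x. cmod (F x) \<partial>lborel)"
    by (simp add: eq norm_mult)
  moreover have "(\<integral>y. \<rho> y \<partial>lborel) \<ge> 0" using \<rho>_nonneg by simp
  ultimately show ?thesis by (simp add: F_def norm_mult)
qed

text \<open>Chebyshev's inequality: if \<open>g (y - x) \<noteq> 0\<close> and \<open>\<bar>x\<bar> \<ge> A\<close>, then \<open>\<bar>y\<bar> \<ge> A - R\<close>, so \<open>\<rho> y\<close> may be multiplied by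
  \<open>\<bar>y\<bar>\<^sup>2 / (A - R)\<^sup>2 \<ge> 1\<close>.\<close>

lemma tail_localized_fourier_le:
  assumes R: "\<And>z. g z \<noteq> 0 \<Longrightarrow> norm z \<le> R" and A: "A > R"
    and mom: "integrable lborel (\<lambda>y. (norm y)\<^sup>2 * \<rho> y)"
  shows "(\<integral>\<^sup>+x. ennreal (cmod (fourier (\<lambda>y. complex_of_real (\<rho> y) * translate x g y) \<xi>)) * indicator (- ball 0 A) x \<partial>lborel)
     \<le> ennreal ((\<integral>y. cmod (g y) \<partial>lborel) * (\<integral>y. (norm y)\<^sup>2 * \<rho> y \<partial>lborel) / (A - R)\<^sup>2)"
proof -
  define G where "G = (\<integral>\<^sup>+x. ennreal (cmod (g x)) \<partial>lborel)"
  have "ennreal (cmod (fourier (\<lambda>y. complex_of_real (\<rho> y) * translate x g y) \<xi>)) * indicator (- ball 0 A) x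
      \<le> (\<integral>\<^sup>+y. ennreal ((norm y)\<^sup>2 * \<rho> y / (A - R)\<^sup>2) * ennreal (cmod (g (y - x))) \<partial>lborel)" for x
  proof (cases "x \<in> ball 0 A")
    case False
    have "ennreal (cmod (fourier (\<lambda>y. complex_of_real (\<rho> y) * translate x g y) \<xi>))
        \<le> (\<integral>\<^sup>+y. ennreal (cmod (cis (- 2 * pi * (y \<bullet> \<xi>)) * (complex_of_real (\<rho> y) * translate x g y))) \<partial>lborel)"
    proof (cases "integrable lborel (\<lambda>y. cis (- 2 * pi * (y \<bullet> \<xi>)) * (complex_of_real (\<rho> y) * translate x g y))")
      case True
      then show ?thesis unfolding fourier_def by (rule integral_norm_bound_ennreal)
    next
      case False
      then show ?thesis unfolding fourier_def by (simp add: not_integrable_integral_eq)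
    qed
    also have "\<dots> \<le> (\<integral>\<^sup>+y. ennreal ((norm y)\<^sup>2 * \<rho> y / (A - R)\<^sup>2) * ennreal (cmod (g (y - x))) \<partial>lborel)"
    proof (intro nn_integral_mono)
      fix y
      have "\<rho> y * cmod (g (y - x)) \<le> (norm y)\<^sup>2 * \<rho> y / (A - R)\<^sup>2 * cmod (g (y - x))"
      proof (cases "g (y - x) = 0")
        case nz: False
        have "norm x \<ge> A" using False by (simp add: dist_norm)
        moreover have "norm x \<le> norm y + norm (y - x)" by norm
        ultimately have "A - R \<le> norm y" using R[OF nz] by linarith
        then have "(A - R)\<^sup>2 \<le> (norm y)\<^sup>2" using A by (intro power_mono) auto
        then have "1 \<le> (norm y)\<^sup>2 / (A - R)\<^sup>2" using A by simp
        then have "1 * (\<rho> y * cmod (g (y - x))) \<le> (norm y)\<^sup>2 / (A - R)\<^sup>2 * (\<rho> y * cmod (g (y - x)))"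
          using \<rho>_nonneg by (intro mult_right_mono) auto
        then show ?thesis by simp
      qed simp
      then show "ennreal (cmod (cis (- 2 * pi * (y \<bullet> \<xi>)) * (complex_of_real (\<rho> y) * translate x g y)))
          \<le> ennreal ((norm y)\<^sup>2 * \<rho> y / (A - R)\<^sup>2) * ennreal (cmod (g (y - x)))"
        using \<rho>_nonneg by (simp add: norm_mult translate_def ennreal_mult[symmetric] ennreal_leI)
    qed
    finally show ?thesis using False by simp
  qed simp
  then have "(\<integral>\<^sup>+x. ennreal (cmod (fourier (\<lambda>y. complex_of_real (\<rho> y) * translate x g y) \<xi>)) * indicator (- ball 0 A) x \<partial>lborel)
      \<le> (\<integral>\<^sup>+x. \<integral>\<^sup>+y. ennreal ((norm y)\<^sup>2 * \<rho> y / (A - R)\<^sup>2) * ennreal (cmod (g (y - x))) \<partial>lborel \<partial>lborel)"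
    by (intro nn_integral_mono) auto
  also have "\<dots> = (\<integral>\<^sup>+y. \<integral>\<^sup>+x. ennreal ((norm y)\<^sup>2 * \<rho> y / (A - R)\<^sup>2) * ennreal (cmod (g (y - x))) \<partial>lborel \<partial>lborel)"
    by (rule lborel_pair.Fubini'[symmetric]) measurable
  also have "\<dots> = (\<integral>\<^sup>+y. ennreal ((norm y)\<^sup>2 * \<rho> y / (A - R)\<^sup>2) * G \<partial>lborel)"
  proof (intro nn_integral_cong)
    fix y
    have "(\<integral>\<^sup>+x. ennreal ((norm y)\<^sup>2 * \<rho> y / (A - R)\<^sup>2) * ennreal (cmod (g (y - x))) \<partial>lborel)
        = ennreal ((norm y)\<^sup>2 * \<rho> y / (A - R)\<^sup>2) * (\<integral>\<^sup>+x. ennreal (cmod (g (y - x))) \<partial>lborel)"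
      by (rule nn_integral_cmult) measurable
    then show "(\<integral>\<^sup>+x. ennreal ((norm y)\<^sup>2 * \<rho> y / (A - R)\<^sup>2) * ennreal (cmod (g (y - x))) \<partial>lborel)
        = ennreal ((norm y)\<^sup>2 * \<rho> y / (A - R)\<^sup>2) * G"
      using nn_integral_reflect[of "\<lambda>x. ennreal (cmod (g x))" y] by (simp add: G_def)
  qed
  also have "\<dots> = (\<integral>\<^sup>+y. ennreal ((norm y)\<^sup>2 * \<rho> y / (A - R)\<^sup>2) \<partial>lborel) * G"
    by (rule nn_integral_multc) measurable
  also have "(\<integral>\<^sup>+y. ennreal ((norm y)\<^sup>2 * \<rho> y / (A - R)\<^sup>2) \<partial>lborel)
      = ennreal (\<integral>y. (norm y)\<^sup>2 * \<rho> y / (A - R)\<^sup>2 \<partial>lborel)"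
    using mom \<rho>_nonneg by (intro nn_integral_eq_integral) auto
  also have "G = ennreal (\<integral>y. cmod (g y) \<partial>lborel)"
    unfolding G_def using g by (intro nn_integral_eq_integral) auto
  finally show ?thesis
    using \<rho>_nonneg by (simp add: ennreal_mult[symmetric] mult.commute)
qed

end

text \<open>A density of mass \<open>N\<close> that lives at scale \<open>\<sigma>\<close> has amalgam norm at least of the order of
  \<open>N \<sigma>\<^bsup>d (1/p - 1)\<^esup>\<close>, the \<open>L\<^sup>p\<close> norm of the density that spreads \<open>N\<close> evenly over a ball of radius
  \<open>\<sigma>\<close>. Choose a small ball \<open>B\<close> of frequencies on which \<open>\<bar>fourier g\<bar> > c\<close>. For \<open>\<xi> \<in> B\<close> the integral of
  \<open>\<bar>F(\<rho> T\<^sub>x g)(\<xi>)\<bar>\<close> over all \<open>x\<close> is at least \<open>c N\<close> by \<open>mass_times_fourier_le\<close>, and at most half of this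
  comes from outside a ball whose radius \<open>A\<close> is a large multiple of \<open>\<sigma>\<close>. It remains to pass from these
  integrals to the norms of exponents \<open>a\<close> over \<open>B\<close> and \<open>p\<close> over the ball of radius \<open>A\<close>.\<close>

lemma wiener_norm_lower_bound:
  fixes g :: "'a::euclidean_space \<Rightarrow> complex"
  assumes g: "continuous_on UNIV g" "g \<noteq> (\<lambda>_. 0)" and K: "compact K" "\<And>x. x \<notin> K \<Longrightarrow> g x = 0"
    and a: "1 \<le> a" and p: "1 \<le> p"
  obtains C where "C > 0"
    and "\<And>\<rho> \<sigma>. \<lbrakk>integrable lborel \<rho>; \<And>y. 0 \<le> \<rho> y; integrable lborel (\<lambda>y. (norm y)\<^sup>2 * \<rho> y); 1 \<le> \<sigma>;
        (\<integral>y. (norm y)\<^sup>2 * \<rho> y \<partial>lborel) \<le> \<sigma>\<^sup>2 * (\<integral>y. \<rho> y \<partial>lborel)\<rbrakk> \<Longrightarrow>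
        ennreal (C * (\<integral>y. \<rho> y \<partial>lborel) * \<sigma> powr (real DIM('a) * (enn2real (inverse p) - 1)))
          \<le> wiener_norm g a p (\<lambda>y. complex_of_real (\<rho> y))"
proof -
  have "integrable lborel (\<lambda>x. indicator K x *\<^sub>R g x)"
    by (intro borel_integrable_compact K continuous_on_subset[OF g(1)]) auto
  then have int_g: "integrable lborel g"
    by (rule Bochner_Integration.integrable_cong[THEN iffD1, rotated 2]) (auto simp: indicator_def K)
  obtain R0 where "\<And>x. x \<in> K \<Longrightarrow> norm x \<le> R0"
    using compact_imp_bounded[OF K(1)] by (auto simp: bounded_iff)
  then have R: "g z \<noteq> 0 \<Longrightarrow> norm z \<le> max R0 1" for z using K(2) by fastforce
  define R where "R = max R0 1"
  have R0: "R \<ge> 1" by (simp add: R_def)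
  obtain \<xi>0 where \<xi>0: "fourier g \<xi>0 \<noteq> 0"
    using fourier_eq_0_imp_zero[OF g(1) int_g K] g(2) by blast
  define c where "c = cmod (fourier g \<xi>0) / 2"
  have c: "c > 0" using \<xi>0 by (simp add: c_def)
  have "isCont (\<lambda>\<xi>. cmod (fourier g \<xi>)) \<xi>0" by (intro continuous_intros isCont_fourier int_g)
  then have "((\<lambda>\<xi>. cmod (fourier g \<xi>)) \<longlongrightarrow> cmod (fourier g \<xi>0)) (nhds \<xi>0)"
    unfolding isCont_def by (rule tendsto_at_iff_tendsto_nhds[THEN iffD1])
  then have "\<forall>\<^sub>F \<xi> in nhds \<xi>0. c < cmod (fourier g \<xi>)"
    by (rule order_tendstoD) (use \<xi>0 in \<open>auto simp: c_def\<close>)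
  then obtain \<delta> where \<delta>: "\<delta> > 0" "\<And>\<xi>. \<xi> \<in> ball \<xi>0 \<delta> \<Longrightarrow> c < cmod (fourier g \<xi>)"
    by (auto simp: eventually_nhds_metric dist_commute)
  define B where "B = ball \<xi>0 \<delta>"
  define b where "b = measure lborel B"
  have b: "emeasure lborel B = ennreal b" "b > 0"
    using \<delta> emeasure_lborel_ball_finite[of \<xi>0 \<delta>]
    by (simp_all add: B_def b_def emeasure_eq_ennreal_measure less_top)
  define G where "G = (\<integral>y. cmod (g y) \<partial>lborel)"
  have G: "G \<ge> 0" by (simp add: G_def)
  \<comment> \<open>The multiple of \<open>\<sigma>\<close> beyond which the tail bound is at most half of the mass bound \<open>c N\<close>.\<close>
  define L where "L = sqrt (2 * G / c) + 1"
  have L: "L > 0" "G / L\<^sup>2 \<le> c / 2"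
  proof -
    show "L > 0" using G c by (simp add: L_def add_nonneg_pos)
    have "2 * G / c = (sqrt (2 * G / c))\<^sup>2" using G c by simp
    also have "\<dots> \<le> L\<^sup>2" unfolding L_def using G c by (intro power_mono) auto
    finally show "G / L\<^sup>2 \<le> c / 2" using c \<open>L > 0\<close> by (simp add: field_simps)
  qed
  define v where "v = unit_ball_vol (real DIM('a)) * (R + L) ^ DIM('a)"
  have v: "v > 0" using R0 L by (simp add: v_def)
  define s where "s = enn2real (inverse p) - 1"
  define k where "k = b powr (enn2real (inverse a) - 1) / 2"
  have k: "k > 0" using b by (simp add: k_def)
  define C where "C = v powr s / 2 * (k * (c / 2 * b))"
  show thesis
  proof
    show "C > 0" using v k c b by (simp add: C_def)
  next
    fix \<rho> :: "'a \<Rightarrow> real" and \<sigma> :: real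
    assume \<rho>: "integrable lborel \<rho>" "\<And>y. 0 \<le> \<rho> y" and mom: "integrable lborel (\<lambda>y. (norm y)\<^sup>2 * \<rho> y)"
      and \<sigma>: "1 \<le> \<sigma>" and le: "(\<integral>y. (norm y)\<^sup>2 * \<rho> y \<partial>lborel) \<le> \<sigma>\<^sup>2 * (\<integral>y. \<rho> y \<partial>lborel)"
    define N where "N = (\<integral>y. \<rho> y \<partial>lborel)"
    have N: "N \<ge> 0" using \<rho> by (simp add: N_def)
    define F where "F x \<xi> = cmod (fourier (\<lambda>y. complex_of_real (\<rho> y) * translate x g y) \<xi>)" for x \<xi>
    note [measurable] = localized_fourier_measurable[OF int_g \<rho>]
    have [measurable]: "(\<lambda>(x, \<xi>). F x \<xi>) \<in> borel_measurable (lborel \<Otimes>\<^sub>M lborel)"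
      unfolding F_def by measurable
    define A where "A = (R + L) * \<sigma>"
    have [measurable]: "ball (0::'a) A \<in> sets borel" "- ball (0::'a) A \<in> sets borel"
      by (auto intro: borel_closed)
    have A: "A > R" "L * \<sigma> \<le> A - R"
    proof -
      have "R * 1 \<le> R * \<sigma>" using R0 \<sigma> by (intro mult_left_mono) auto
      then show "L * \<sigma> \<le> A - R" by (simp add: A_def algebra_simps)
      moreover have "L * \<sigma> > 0" using L \<sigma> by simp
      ultimately show "A > R" by linarith
    qed
    have bulk: "ennreal (N * (c / 2)) \<le> (\<integral>\<^sup>+x. ennreal (F x \<xi>) * indicator (ball 0 A) x \<partial>lborel)"
      if "\<xi> \<in> B" for \<xi>
    proof -
      have [measurable]: "(\<lambda>x. F x \<xi>) \<in> borel_measurable lborel" by measurable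
      have "G * (\<integral>y. (norm y)\<^sup>2 * \<rho> y \<partial>lborel) / (A - R)\<^sup>2 \<le> G * (\<sigma>\<^sup>2 * N) / (L * \<sigma>)\<^sup>2"
        using le A L \<sigma> G N \<rho> by (intro frac_le mult_left_mono power_mono mult_nonneg_nonneg) (auto simp: N_def)
      also have "\<dots> = N * (G / L\<^sup>2)" using \<sigma> by (simp add: power_mult_distrib)
      also have "\<dots> \<le> N * (c / 2)" using L N by (intro mult_left_mono) auto
      finally have tail: "(\<integral>\<^sup>+x. ennreal (F x \<xi>) * indicator (- ball 0 A) x \<partial>lborel) \<le> ennreal (N * (c / 2))"
        using tail_localized_fourier_le[OF int_g \<rho> R[folded R_def] A(1) mom, of \<xi>]
        unfolding F_def G_def by (meson ennreal_leI order_trans)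
      have "ennreal (N * (c / 2)) + ennreal (N * (c / 2)) = ennreal (N * c)"
        using N c by (simp add: ennreal_plus[symmetric] del: ennreal_plus)
      also have "\<dots> \<le> ennreal (N * cmod (fourier g \<xi>))"
        using \<delta>(2)[of \<xi>] that N by (intro ennreal_leI mult_left_mono) (auto simp: B_def)
      also have "\<dots> \<le> (\<integral>\<^sup>+x. ennreal (F x \<xi>) \<partial>lborel)"
        unfolding F_def N_def by (rule mass_times_fourier_le[OF int_g \<rho>])
      also have "\<dots> = (\<integral>\<^sup>+x. ennreal (F x \<xi>) * indicator (ball 0 A) x + ennreal (F x \<xi>) * indicator (- ball 0 A) x \<partial>lborel)"
        by (intro nn_integral_cong) (auto simp: indicator_def)
      also have "\<dots> = (\<integral>\<^sup>+x. ennreal (F x \<xi>) * indicator (ball 0 A) x \<partial>lborel)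
          + (\<integral>\<^sup>+x. ennreal (F x \<xi>) * indicator (- ball 0 A) x \<partial>lborel)"
        by (rule nn_integral_add) measurable
      also have "\<dots> \<le> (\<integral>\<^sup>+x. ennreal (F x \<xi>) * indicator (ball 0 A) x \<partial>lborel) + ennreal (N * (c / 2))"
        using tail by (intro add_left_mono)
      finally have "ennreal (N * (c / 2)) + ennreal (N * (c / 2))
          \<le> ennreal (N * (c / 2)) + (\<integral>\<^sup>+x. ennreal (F x \<xi>) * indicator (ball 0 A) x \<partial>lborel)"
        by (simp only: add.commute)
      then show ?thesis unfolding ennreal_add_left_cancel_le by simp
    qed
    define J where "J x = (\<integral>\<^sup>+\<xi>. ennreal (F x \<xi>) * indicator B \<xi> \<partial>lborel)" for x
    have [measurable]: "B \<in> sets lborel" by (simp add: B_def)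
    have J_meas [measurable]: "J \<in> borel_measurable lborel" unfolding J_def by measurable
    have local: "ennreal k * J x \<le> fourier_Lp_norm a (\<lambda>y. complex_of_real (\<rho> y) * translate x g y)" for x
      unfolding fourier_Lp_norm_def J_def k_def F_def[symmetric]
      by (rule Lp_norm_ge_integral[OF _ _ b a]) measurable
    have "ennreal (N * (c / 2) * b) = (\<integral>\<^sup>+\<xi>. ennreal (N * (c / 2)) * indicator B \<xi> \<partial>lborel)"
      using b N c by (subst nn_integral_cmult_indicator) (auto simp: B_def ennreal_mult[symmetric])
    also have "\<dots> \<le> (\<integral>\<^sup>+\<xi>. \<integral>\<^sup>+x. ennreal (F x \<xi>) * indicator (ball 0 A) x * indicator B \<xi> \<partial>lborel \<partial>lborel)"
    proof (intro nn_integral_mono)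
      fix \<xi>
      show "ennreal (N * (c / 2)) * indicator B \<xi>
          \<le> (\<integral>\<^sup>+x. ennreal (F x \<xi>) * indicator (ball 0 A) x * indicator B \<xi> \<partial>lborel)"
        using bulk[of \<xi>] by (cases "\<xi> \<in> B") auto
    qed
    also have "\<dots> = (\<integral>\<^sup>+x. \<integral>\<^sup>+\<xi>. ennreal (F x \<xi>) * indicator (ball 0 A) x * indicator B \<xi> \<partial>lborel \<partial>lborel)"
      by (rule lborel_pair.Fubini') measurable
    also have "\<dots> = (\<integral>\<^sup>+x. J x * indicator (ball 0 A) x \<partial>lborel)"
      unfolding J_def by (intro nn_integral_cong) (auto simp: indicator_def)
    finally have Jint: "ennreal (N * (c / 2) * b) \<le> (\<integral>\<^sup>+x. J x * indicator (ball 0 A) x \<partial>lborel)" .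

    have A0: "A > 0" using A R0 by linarith
    have vol: "emeasure lborel (ball (0::'a) A) = ennreal (v * \<sigma> ^ DIM('a))"
      using A0 by (simp add: emeasure_ball v_def A_def power_mult_distrib mult.assoc)
    have vol_pos: "v * \<sigma> ^ DIM('a) > 0" using v \<sigma> by simp
    have "\<sigma> powr (real DIM('a) * s) = (\<sigma> ^ DIM('a)) powr s"
      using \<sigma> by (simp add: powr_powr[symmetric] powr_realpow)
    then have CN: "C * N * \<sigma> powr (real DIM('a) * s) = ((v * \<sigma> ^ DIM('a)) powr s / 2) * (k * (N * (c / 2) * b))"
      using v \<sigma> by (simp add: C_def powr_mult)
    have mult3: "ennreal (a * (k * y)) = ennreal a * (ennreal k * ennreal y)"
      if "a \<ge> 0" "k \<ge> 0" "y \<ge> 0" for a k y :: real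
      using that by (simp add: ennreal_mult)
    have "ennreal (C * N * \<sigma> powr (real DIM('a) * s))
        = ennreal ((v * \<sigma> ^ DIM('a)) powr s / 2) * (ennreal k * ennreal (N * (c / 2) * b))"
      unfolding CN by (rule mult3) (use k N c b in auto)
    also have "\<dots> \<le> ennreal ((v * \<sigma> ^ DIM('a)) powr s / 2) * (ennreal k * (\<integral>\<^sup>+x. J x * indicator (ball 0 A) x \<partial>lborel))"
      using Jint by (intro mult_left_mono) auto
    also have "ennreal k * (\<integral>\<^sup>+x. J x * indicator (ball 0 A) x \<partial>lborel)
        = (\<integral>\<^sup>+x. (ennreal k * J x) * indicator (ball 0 A) x \<partial>lborel)"
      by (subst nn_integral_cmult[symmetric]) (auto simp: mult.assoc)
    also have "ennreal ((v * \<sigma> ^ DIM('a)) powr s / 2) * \<dots> \<le> Lp_norm p lborel (\<lambda>x. ennreal k * J x)"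
      unfolding s_def by (rule Lp_norm_ge_integral[OF _ _ vol vol_pos p]) measurable
    also have "\<dots> \<le> wiener_norm g a p (\<lambda>y. complex_of_real (\<rho> y))"
      unfolding wiener_norm_def by (rule Lp_norm_mono) (rule local)
    finally show "ennreal (C * (\<integral>y. \<rho> y \<partial>lborel) * \<sigma> powr (real DIM('a) * (enn2real (inverse p) - 1)))
        \<le> wiener_norm g a p (\<lambda>y. complex_of_real (\<rho> y))"
      by (simp add: N_def s_def)
  qed
qed

section \<open>Polynomials times Gaussians\<close>

text \<open>An exponential majorant is convenient because products of such majorants are again of this form, and a
  Gaussian absorbs it by completing the square.\<close>

lemma real_polynomial_function_exp_bound:
  "real_polynomial_function p \<Longrightarrow> \<exists>C k. 0 \<le> C \<and> 0 \<le> k \<and> (\<forall>x. \<bar>p x\<bar> \<le> C * exp (k * norm x))"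
proof (induction rule: real_polynomial_function.induct)
  case (linear f)
  then obtain K where K: "K \<ge> 0" "\<And>x. norm (f x) \<le> norm x * K"
    using bounded_linear.nonneg_bounded by blast
  have "\<bar>f x\<bar> \<le> K * exp (1 * norm x)" for x
  proof -
    have "norm x \<le> exp (norm x)" using exp_ge_add_one_self[of "norm x"] by linarith
    then have "norm x * K \<le> exp (norm x) * K" using K by (intro mult_right_mono) auto
    then show ?thesis using K(2)[of x] by (simp add: mult.commute)
  qed
  then show ?case using K by (intro exI[of _ K] exI[of _ 1]) auto
next
  case (const c)
  show ?case by (intro exI[of _ "\<bar>c\<bar>"] exI[of _ 0]) auto
next
  case (add f g)
  then obtain C k D l where *: "C \<ge> 0" "k \<ge> 0" "\<And>x. \<bar>f x\<bar> \<le> C * exp (k * norm x)"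
    "D \<ge> 0" "l \<ge> 0" "\<And>x. \<bar>g x\<bar> \<le> D * exp (l * norm x)" by blast
  have "\<bar>f x + g x\<bar> \<le> (C + D) * exp ((k + l) * norm x)" for x
  proof -
    have "exp (k * norm x) \<le> exp ((k + l) * norm x)" "exp (l * norm x) \<le> exp ((k + l) * norm x)"
      using * by (auto simp: distrib_right)
    then have "C * exp (k * norm x) \<le> C * exp ((k + l) * norm x)" "D * exp (l * norm x) \<le> D * exp ((k + l) * norm x)"
      using * by (auto intro: mult_left_mono)
    then show ?thesis using *(3)[of x] *(6)[of x] by (simp add: distrib_right[of C])
  qed
  then show ?case using * by (intro exI[of _ "C + D"] exI[of _ "k + l"]) auto
next
  case (mult f g)
  then obtain C k D l where *: "C \<ge> 0" "k \<ge> 0" "\<And>x. \<bar>f x\<bar> \<le> C * exp (k * norm x)"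
    "D \<ge> 0" "l \<ge> 0" "\<And>x. \<bar>g x\<bar> \<le> D * exp (l * norm x)" by blast
  have "\<bar>f x * g x\<bar> \<le> (C * D) * exp ((k + l) * norm x)" for x
  proof -
    have "\<bar>f x * g x\<bar> \<le> (C * exp (k * norm x)) * (D * exp (l * norm x))"
      unfolding abs_mult using * by (intro mult_mono) auto
    moreover have "exp ((k + l) * norm x) = exp (k * norm x) * exp (l * norm x)"
      by (simp add: distrib_right exp_add)
    ultimately show ?thesis by (simp add: mult_ac)
  qed
  then show ?case using * by (intro exI[of _ "C * D"] exI[of _ "k + l"]) auto
qed

lemma polynomial_gaussian_bounded:
  assumes "real_polynomial_function p" "c > 0"
  obtains B where "B \<ge> 0" "\<And>x. \<bar>p x\<bar> * exp (- c * (norm x)\<^sup>2) \<le> B"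
proof -
  obtain C k where C: "C \<ge> 0" "k \<ge> 0" "\<And>x. \<bar>p x\<bar> \<le> C * exp (k * norm x)"
    using real_polynomial_function_exp_bound[OF assms(1)] by blast
  have "\<bar>p x\<bar> * exp (- c * (norm x)\<^sup>2) \<le> C * exp (k\<^sup>2 / (4 * c))" for x
  proof -
    have "0 \<le> (norm x - k / (2 * c))\<^sup>2 * c" using assms by simp
    also have "\<dots> = c * (norm x)\<^sup>2 - k * norm x + k\<^sup>2 / (4 * c)"
      using assms by (simp add: power2_eq_square field_simps)
    finally have "k * norm x + - c * (norm x)\<^sup>2 \<le> k\<^sup>2 / (4 * c)" by simp
    then have e: "exp (k * norm x) * exp (- c * (norm x)\<^sup>2) \<le> exp (k\<^sup>2 / (4 * c))"
      unfolding exp_add[symmetric] by simp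
    have "\<bar>p x\<bar> * exp (- c * (norm x)\<^sup>2) \<le> C * exp (k * norm x) * exp (- c * (norm x)\<^sup>2)"
      using C by (intro mult_right_mono) auto
    also have "\<dots> \<le> C * exp (k\<^sup>2 / (4 * c))"
      unfolding mult.assoc using C e by (intro mult_left_mono)
    finally show ?thesis .
  qed
  then show thesis using C by (intro that[of "C * exp (k\<^sup>2 / (4 * c))"]) auto
qed

lemma real_polynomial_function_ident [simp, intro]: "real_polynomial_function (\<lambda>s::real. s)"
  by (rule real_polynomial_function.intros(1)) (rule bounded_linear_ident)

lemma polynomial_gaussian_integrable:
  fixes p :: "real \<Rightarrow> real"
  assumes "real_polynomial_function p" "c > 0"
  shows "integrable lborel (\<lambda>s. p s * exp (- c * s\<^sup>2))"
proof -
  have "real_polynomial_function (\<lambda>s. (1 + s\<^sup>2) * p s)"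
    using assms by (intro real_polynomial_function.intros(2-4) real_polynomial_function_power) auto
  then obtain B where B: "\<And>s. \<bar>(1 + s\<^sup>2) * p s\<bar> * exp (- c * (norm s)\<^sup>2) \<le> B"
    using polynomial_gaussian_bounded assms(2) by blast
  have "integrable lborel (\<lambda>s. B * inverse (1 + s\<^sup>2))"
    using integrable_inverse_1_plus_square by (auto simp: set_integrable_def)
  then show ?thesis
  proof (rule Bochner_Integration.integrable_bound)
    have "continuous_on UNIV p"
      using assms(1) by (intro continuous_at_imp_continuous_on ballI differentiable_imp_continuous_within
          differentiable_at_real_polynomial_function)
    then show "(\<lambda>s. p s * exp (- c * s\<^sup>2)) \<in> borel_measurable lborel"
      by (auto intro!: borel_measurable_continuous_onI continuous_intros)
    show "AE s in lborel. norm (p s * exp (- c * s\<^sup>2)) \<le> norm (B * inverse (1 + s\<^sup>2))"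
    proof (intro AE_I2)
      fix s :: real
      have "1 + s\<^sup>2 > 0" by (simp add: add_pos_nonneg)
      then have "norm (p s * exp (- c * s\<^sup>2)) \<le> B * inverse (1 + s\<^sup>2)"
        using B[of s] by (simp add: abs_mult divide_inverse[symmetric] pos_le_divide_eq mult_ac)
      then show "norm (p s * exp (- c * s\<^sup>2)) \<le> norm (B * inverse (1 + s\<^sup>2))" by simp
    qed
  qed
qed

lemma polynomial_gaussian_tendsto_0:
  fixes p :: "real \<Rightarrow> real"
  assumes "real_polynomial_function p" "c > 0"
  shows "((\<lambda>s. p s * exp (- c * s\<^sup>2)) \<longlongrightarrow> 0) at_infinity"
proof -
  have "real_polynomial_function (\<lambda>s. s * p s)"
    using assms by (intro real_polynomial_function.intros(2-4)) auto
  then obtain B where B: "\<And>s. \<bar>s * p s\<bar> * exp (- c * (norm s)\<^sup>2) \<le> B"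
    using polynomial_gaussian_bounded assms(2) by blast
  have "((\<lambda>s. B * inverse \<bar>s\<bar>) \<longlongrightarrow> B * 0) at_infinity"
    using tendsto_norm_zero[OF tendsto_inverse_0[where 'a = real]]
    by (intro tendsto_mult tendsto_const) simp
  then have "((\<lambda>s. B * inverse \<bar>s\<bar>) \<longlongrightarrow> 0) at_infinity" by simp
  moreover have "\<forall>\<^sub>F s in at_infinity. norm (p s * exp (- c * s\<^sup>2)) \<le> B * inverse \<bar>s\<bar>"
    unfolding eventually_at_infinity
  proof (intro exI[of _ 1] allI impI)
    fix s :: real assume "1 \<le> norm s"
    then show "norm (p s * exp (- c * s\<^sup>2)) \<le> B * inverse \<bar>s\<bar>"
      using B[of s] by (simp add: abs_mult field_simps)
  qed
  ultimately show ?thesis by (rule Lim_null_comparison[rotated])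
qed

text \<open>Integration by parts without boundary terms: the derivative of a function that vanishes at \<open>\<plusminus>\<infinity>\<close> has
  integral zero.\<close>

lemma integral_deriv_polynomial_gaussian:
  fixes p q :: "real \<Rightarrow> real"
  assumes p: "real_polynomial_function p" and q: "real_polynomial_function q" and c: "c > 0"
    and deriv: "\<And>s. ((\<lambda>s. p s * exp (- c * s\<^sup>2)) has_real_derivative q s * exp (- c * s\<^sup>2)) (at s)"
  shows "(\<integral>s. q s * exp (- c * s\<^sup>2) \<partial>lborel) = 0"
proof -
  have "(LBINT s=-\<infinity>..\<infinity>. q s * exp (- c * s\<^sup>2)) = 0 - 0"
  proof (rule interval_integral_FTC_integrable)
    show "((\<lambda>s. p s * exp (- c * s\<^sup>2)) has_vector_derivative q s * exp (- c * s\<^sup>2)) (at s)" for s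
      using deriv by (simp add: has_real_derivative_iff_has_vector_derivative)
    show "isCont (\<lambda>s. q s * exp (- c * s\<^sup>2)) s" for s
    proof -
      have "isCont q s"
        by (intro differentiable_imp_continuous_within differentiable_at_real_polynomial_function q)
      then show ?thesis by simp
    qed
    show "set_integrable lborel (einterval (-\<infinity>) \<infinity>) (\<lambda>s. q s * exp (- c * s\<^sup>2))"
      using polynomial_gaussian_integrable[OF q c] by (simp add: set_integrable_def)
    show "(((\<lambda>s. p s * exp (- c * s\<^sup>2)) \<circ> real_of_ereal) \<longlongrightarrow> 0) (at_right (-\<infinity>))"
      unfolding ereal_tendsto_simps
      by (rule filterlim_mono[OF polynomial_gaussian_tendsto_0[OF p c] order_refl]) (rule at_bot_le_at_infinity)
    show "(((\<lambda>s. p s * exp (- c * s\<^sup>2)) \<circ> real_of_ereal) \<longlongrightarrow> 0) (at_left \<infinity>)"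
      unfolding ereal_tendsto_simps
      by (rule filterlim_mono[OF polynomial_gaussian_tendsto_0[OF p c] order_refl]) (rule at_top_le_at_infinity)
  qed simp
  then show ?thesis
    by (simp add: interval_lebesgue_integral_def set_lebesgue_integral_def)
qed

section \<open>Hermite functions on the line\<close>

text \<open>The Hermite polynomials orthogonal with respect to the weight \<open>exp (- 2 * pi * s\<^sup>2)\<close>, not normalized. For
  \<open>n = 0\<close> the factor \<open>n\<close> annihilates the term with the truncated index \<open>n - 1\<close>.\<close>

fun hermite_poly :: "nat \<Rightarrow> real \<Rightarrow> real" where
  "hermite_poly 0 s = 1"
| "hermite_poly (Suc n) s = 4 * pi * s * hermite_poly n s - 4 * pi * n * hermite_poly (n - 1) s"

lemma real_polynomial_function_hermite [simp, intro]: "real_polynomial_function (hermite_poly n)"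
proof (induction n rule: less_induct)
  case (less n)
  show ?case
  proof (cases n)
    case 0
    then show ?thesis by (simp add: real_polynomial_function.intros(2))
  next
    case (Suc m)
    have eq: "hermite_poly n = (\<lambda>s. (4 * pi * s) * hermite_poly m s - (4 * pi * m) * hermite_poly (m - 1) s)"
      by (simp add: Suc fun_eq_iff)
    show ?thesis unfolding eq
      using Suc by (intro real_polynomial_function_diff real_polynomial_function.intros(2-4) less) auto
  qed
qed

lemma hermite_poly_deriv:
  "(hermite_poly n has_real_derivative 4 * pi * n * hermite_poly (n - 1) s) (at s)"
proof (induction n rule: less_induct)
  case (less n)
  show ?case
  proof (cases n)
    case (Suc m)
    have IH: "(hermite_poly m has_real_derivative 4 * pi * m * hermite_poly (m - 1) s) (at s)"
      "(hermite_poly (m - 1) has_real_derivative 4 * pi * (m - 1 :: nat) * hermite_poly (m - 1 - 1) s) (at s)"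
      using Suc by (intro less; simp)+
    have eq: "hermite_poly n = (\<lambda>s. 4 * pi * s * hermite_poly m s - 4 * pi * m * hermite_poly (m - 1) s)"
      by (simp add: Suc fun_eq_iff)
    have "(hermite_poly n has_real_derivative
        4 * pi * hermite_poly m s + 4 * pi * s * (4 * pi * m * hermite_poly (m - 1) s)
        - 4 * pi * m * (4 * pi * (m - 1 :: nat) * hermite_poly (m - 1 - 1) s)) (at s)"
      unfolding eq by (rule derivative_eq_intros IH refl | simp)+
    also have "4 * pi * hermite_poly m s + 4 * pi * s * (4 * pi * m * hermite_poly (m - 1) s)
        - 4 * pi * m * (4 * pi * (m - 1 :: nat) * hermite_poly (m - 1 - 1) s)
        = 4 * pi * n * hermite_poly m s"
      using Suc by (cases m) (auto simp: algebra_simps)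
    finally show ?thesis by (simp add: Suc)
  qed simp
qed

definition hermite :: "nat \<Rightarrow> real \<Rightarrow> real" where
  "hermite n s = hermite_poly n s * exp (- pi * s\<^sup>2)"

lemma hermite_Suc: "hermite (Suc n) s = 4 * pi * s * hermite n s - 4 * pi * n * hermite (n - 1) s"
  by (simp add: hermite_def algebra_simps)

lemma hermite_deriv:
  "(hermite n has_real_derivative 4 * pi * n * hermite (n - 1) s - 2 * pi * s * hermite n s) (at s)"
  unfolding hermite_def[abs_def]
  by (rule derivative_eq_intros hermite_poly_deriv refl | simp add: algebra_simps)+

text \<open>The eigenvalue equation of the one-dimensional oscillator: divided by \<open>- 4 * pi\<close>, it states that
  \<open>- h'' / (4 \<pi>) + \<pi> s\<^sup>2 h = (n + 1/2) h\<close>.\<close>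

lemma hermite_deriv2:
  "((\<lambda>s. 4 * pi * n * hermite (n - 1) s - 2 * pi * s * hermite n s)
     has_real_derivative (4 * pi\<^sup>2 * s\<^sup>2 - 2 * pi * (2 * real n + 1)) * hermite n s) (at s)"
proof -
  have "((\<lambda>s. 4 * pi * n * hermite (n - 1) s - 2 * pi * s * hermite n s)
     has_real_derivative 4 * pi * n * (4 * pi * (n - 1 :: nat) * hermite (n - 1 - 1) s - 2 * pi * s * hermite (n - 1) s)
       - (2 * pi * hermite n s + 2 * pi * s * (4 * pi * n * hermite (n - 1) s - 2 * pi * s * hermite n s))) (at s)"
    by (rule derivative_eq_intros hermite_deriv refl | simp)+
  moreover have "4 * pi * n * (4 * pi * (n - 1 :: nat) * hermite (n - 1 - 1) s - 2 * pi * s * hermite (n - 1) s)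
       - (2 * pi * hermite n s + 2 * pi * s * (4 * pi * n * hermite (n - 1) s - 2 * pi * s * hermite n s))
      = (4 * pi\<^sup>2 * s\<^sup>2 - 2 * pi * (2 * real n + 1)) * hermite n s"
  proof (cases n)
    case (Suc m)
    have "4 * pi * m * hermite (m - 1) s = 4 * pi * s * hermite m s - hermite n s"
      using Suc by (simp add: hermite_Suc)
    then have eq: "4 * pi * real (n - 1) * hermite (n - 1 - 1) s = 4 * pi * s * hermite m s - hermite n s"
      using Suc by simp
    show ?thesis unfolding eq using Suc by (simp add: power2_eq_square algebra_simps)
  qed (simp add: power2_eq_square algebra_simps)
  ultimately show ?thesis by (simp only:)
qed

lemma hermite_poly_gaussian_integrable:
  assumes "real_polynomial_function p"
  shows "integrable lborel (\<lambda>s. p s * (hermite n s * hermite m s))"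
proof -
  have "integrable lborel (\<lambda>s. (p s * (hermite_poly n s * hermite_poly m s)) * exp (- (2 * pi) * s\<^sup>2))"
    using assms by (intro polynomial_gaussian_integrable real_polynomial_function.intros(2-4)) auto
  moreover have "(p s * (hermite_poly n s * hermite_poly m s)) * exp (- (2 * pi) * s\<^sup>2)
      = p s * (hermite n s * hermite m s)" for s
    by (simp add: hermite_def exp_add[symmetric] algebra_simps)
  ultimately show ?thesis by (simp only:)
qed

lemma hermite_integrable: "integrable lborel (\<lambda>s. hermite n s * hermite m s)"
  using hermite_poly_gaussian_integrable[OF real_polynomial_function.intros(2)[of 1]] by simp

text \<open>The raising operator \<open>2 \<pi> s - d/ds\<close>, which maps \<open>hermite n\<close> to \<open>hermite (Suc n)\<close>, is adjoint to the
  lowering operator \<open>2 \<pi> s + d/ds\<close>, which maps \<open>hermite m\<close> to \<open>4 \<pi> m hermite (m - 1)\<close>. In terms of integrals, the derivative of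
  \<open>hermite n * hermite m\<close> has integral zero.\<close>

lemma hermite_integral_Suc:
  "(\<integral>s. hermite (Suc n) s * hermite m s \<partial>lborel) = 4 * pi * m * (\<integral>s. hermite n s * hermite (m - 1) s \<partial>lborel)"
proof -
  define p where "p s = hermite_poly n s * hermite_poly m s" for s
  define q where "q s = (4 * pi * m) * (hermite_poly n s * hermite_poly (m - 1) s) - hermite_poly (Suc n) s * hermite_poly m s" for s
  have g: "exp (- (2 * pi) * s\<^sup>2) = exp (- pi * s\<^sup>2) * exp (- pi * s\<^sup>2)" for s :: real
    by (simp add: exp_add[symmetric])
  have pg: "p s * exp (- (2 * pi) * s\<^sup>2) = hermite n s * hermite m s" for s
    unfolding g p_def hermite_def by (simp add: mult_ac)
  have qg: "q s * exp (- (2 * pi) * s\<^sup>2) = 4 * pi * m * (hermite n s * hermite (m - 1) s) - hermite (Suc n) s * hermite m s" for s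
    unfolding g q_def hermite_def left_diff_distrib by (simp only: mult_ac)
  have "(\<integral>s. q s * exp (- (2 * pi) * s\<^sup>2) \<partial>lborel) = 0"
  proof (rule integral_deriv_polynomial_gaussian)
    show "real_polynomial_function p" unfolding p_def by (intro real_polynomial_function.intros(2-4)) auto
    show "real_polynomial_function q" unfolding q_def
      by (intro real_polynomial_function_diff real_polynomial_function.intros(2-4) real_polynomial_function_hermite)
    fix s
    have "((\<lambda>s. hermite n s * hermite m s) has_real_derivative
       (4 * pi * n * hermite (n - 1) s - 2 * pi * s * hermite n s) * hermite m s
       + (4 * pi * m * hermite (m - 1) s - 2 * pi * s * hermite m s) * hermite n s) (at s)"
      by (rule DERIV_mult hermite_deriv)+
    then show "((\<lambda>s. p s * exp (- (2 * pi) * s\<^sup>2)) has_real_derivative q s * exp (- (2 * pi) * s\<^sup>2)) (at s)"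
      unfolding pg qg by (simp add: hermite_Suc algebra_simps)
  qed simp
  then show ?thesis unfolding qg by (simp add: hermite_integrable)
qed

definition hermite_sq_norm :: "nat \<Rightarrow> real" where
  "hermite_sq_norm n = (\<integral>s. hermite n s * hermite n s \<partial>lborel)"

lemma hermite_sq_norm_Suc: "hermite_sq_norm (Suc n) = 4 * pi * real (Suc n) * hermite_sq_norm n"
  unfolding hermite_sq_norm_def by (subst hermite_integral_Suc) simp

lemma hermite_sq_norm_pos: "hermite_sq_norm n > 0"
proof (induction n)
  case 0
  have "hermite_sq_norm 0 \<noteq> 0"
  proof
    assume "hermite_sq_norm 0 = 0"
    then have "AE s in lborel. hermite 0 s * hermite 0 s = 0"
      unfolding hermite_sq_norm_def by (subst (asm) integral_nonneg_eq_0_iff_AE) (auto intro: hermite_integrable)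
    then have "AE s in lborel :: real measure. False" by (simp add: hermite_def)
    then have "ae_filter (lborel :: real measure) = bot" by (simp add: trivial_limit_def)
    then show False by (simp add: ae_filter_eq_bot_iff)
  qed
  moreover have "hermite_sq_norm 0 \<ge> 0" unfolding hermite_sq_norm_def by simp
  ultimately show ?case by simp
qed (simp add: hermite_sq_norm_Suc)

lemma hermite_orthogonal:
  "(\<integral>s. hermite n s * hermite m s \<partial>lborel) = (if n = m then hermite_sq_norm n else 0)"
proof (induction n arbitrary: m)
  case 0
  show ?case
  proof (cases m)
    case (Suc k)
    then show ?thesis using hermite_integral_Suc[of k 0] by (simp add: mult.commute)
  qed (simp add: hermite_sq_norm_def)
next
  case (Suc n)
  show ?case
    using Suc by (cases m) (auto simp: hermite_integral_Suc hermite_sq_norm_Suc)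
qed

text \<open>Expand \<open>4 \<pi> s hermite n\<close> by the recurrence in \<open>hermite (Suc n)\<close> and \<open>hermite (n - 1)\<close>, which are orthogonal.\<close>

lemma hermite_second_moment:
  "(\<integral>s. s\<^sup>2 * (hermite n s * hermite n s) \<partial>lborel) = (2 * real n + 1) / (4 * pi) * hermite_sq_norm n"
proof -
  define c where "c = 4 * pi * real n"
  have "(4 * pi)\<^sup>2 * (s\<^sup>2 * (hermite n s * hermite n s))
      = hermite (Suc n) s * hermite (Suc n) s + 2 * c * (hermite (Suc n) s * hermite (n - 1) s)
        + c\<^sup>2 * (hermite (n - 1) s * hermite (n - 1) s)" for s
  proof -
    have "(4 * pi)\<^sup>2 * (s\<^sup>2 * (hermite n s * hermite n s)) = (4 * pi * s * hermite n s)\<^sup>2"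
      by (simp add: power2_eq_square mult_ac)
    also have "4 * pi * s * hermite n s = hermite (Suc n) s + c * hermite (n - 1) s"
      by (simp add: hermite_Suc c_def)
    finally show ?thesis by (simp add: power2_eq_square algebra_simps)
  qed
  then have "(\<integral>s. (4 * pi)\<^sup>2 * (s\<^sup>2 * (hermite n s * hermite n s)) \<partial>lborel)
      = (\<integral>s. hermite (Suc n) s * hermite (Suc n) s + 2 * c * (hermite (Suc n) s * hermite (n - 1) s)
        + c\<^sup>2 * (hermite (n - 1) s * hermite (n - 1) s) \<partial>lborel)"
    by (simp only:)
  also have "\<dots> = hermite_sq_norm (Suc n) + c\<^sup>2 * hermite_sq_norm (n - 1)"
    using hermite_integrable by (simp add: hermite_orthogonal)
  also have "\<dots> = 4 * pi * (2 * real n + 1) * hermite_sq_norm n"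
  proof (cases n)
    case (Suc m)
    have "c\<^sup>2 * hermite_sq_norm (n - 1) = c * hermite_sq_norm n"
      using Suc by (simp add: power2_eq_square c_def hermite_sq_norm_Suc)
    then show ?thesis by (simp add: hermite_sq_norm_Suc c_def algebra_simps)
  qed (simp add: c_def hermite_sq_norm_Suc)
  finally have "(4 * pi)\<^sup>2 * (\<integral>s. s\<^sup>2 * (hermite n s * hermite n s) \<partial>lborel) = 4 * pi * (2 * real n + 1) * hermite_sq_norm n"
    by (simp only: integral_mult_right_zero)
  moreover have "(4 * pi)\<^sup>2 = 4 * pi * (4 * pi)" by (simp add: power2_eq_square)
  ultimately have "4 * pi * (\<integral>s. s\<^sup>2 * (hermite n s * hermite n s) \<partial>lborel) = (2 * real n + 1) * hermite_sq_norm n"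
    by (simp only: mult.assoc) simp
  then show ?thesis by (simp add: eq_divide_eq mult_ac)
qed

section \<open>Integrals of product functions\<close>

lemma
  fixes F :: "'a::euclidean_space \<Rightarrow> real \<Rightarrow> real"
  assumes F: "\<And>b. b \<in> Basis \<Longrightarrow> integrable lborel (F b)"
  shows integrable_lborel_prod: "integrable lborel (\<lambda>x. \<Prod>b\<in>Basis. F b (x \<bullet> b))"
    and integral_lborel_prod: "(\<integral>x. (\<Prod>b\<in>Basis. F b (x \<bullet> b)) \<partial>lborel) = (\<Prod>b\<in>Basis. (\<integral>s. F b s \<partial>lborel))"
proof -
  interpret product_sigma_finite "\<lambda>_::'a. lborel :: real measure" ..
  have [measurable]: "F b \<in> borel_measurable borel" if "b \<in> Basis" for b
    using borel_measurable_integrable[OF F[OF that]] by simp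
  have T [measurable]: "(\<lambda>f. \<Sum>b\<in>Basis. f b *\<^sub>R b) \<in> measurable (\<Pi>\<^sub>M b\<in>Basis. lborel) (borel :: 'a measure)"
    by measurable
  have [measurable]: "(\<lambda>x::'a. \<Prod>b\<in>Basis. F b (x \<bullet> b)) \<in> borel_measurable borel" by measurable
  have eq: "(\<Prod>b\<in>Basis. F b ((\<Sum>c\<in>Basis. f c *\<^sub>R c) \<bullet> b)) = (\<Prod>b\<in>Basis. F b (f b))" for f
    by (intro prod.cong refl) simp
  show "integrable lborel (\<lambda>x. \<Prod>b\<in>Basis. F b (x \<bullet> b))"
    by (subst lborel_eq, subst integrable_distr_eq) (auto simp: eq intro!: product_integrable_prod F)
  have "(\<integral>x. (\<Prod>b\<in>Basis. F b (x \<bullet> b)) \<partial>lborel) = (\<integral>f. (\<Prod>b\<in>Basis. F b (f b)) \<partial>(\<Pi>\<^sub>M b\<in>Basis. lborel))"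
    by (subst lborel_eq, subst integral_distr) (auto simp: eq)
  also have "\<dots> = (\<Prod>b\<in>Basis. (\<integral>s. F b s \<partial>lborel))"
    by (rule product_integral_prod) (auto intro: F)
  finally show "(\<integral>x. (\<Prod>b\<in>Basis. F b (x \<bullet> b)) \<partial>lborel) = (\<Prod>b\<in>Basis. (\<integral>s. F b s \<partial>lborel))" .
qed

lemma norm_power2_eq_sum_Basis:
  fixes x :: "'a::euclidean_space"
  shows "(norm x)\<^sup>2 = (\<Sum>b\<in>Basis. (x \<bullet> b)\<^sup>2)"
  unfolding power2_norm_eq_inner by (subst euclidean_inner) (simp add: power2_eq_square)

section \<open>Schwartz functions of the form polynomial times Gaussian\<close>

text \<open>The class of polynomials is closed under derivatives in a fixed direction \<open>b\<close>. The derivative and its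
  value at \<open>b\<close> are carried together through the induction, since the product rule needs both.\<close>

lemma real_polynomial_function_directional_derivative:
  "real_polynomial_function p \<Longrightarrow>
     \<exists>q. real_polynomial_function q \<and> (\<forall>x. \<exists>D. (p has_derivative D) (at x) \<and> D b = q x)"
proof (induction rule: real_polynomial_function.induct)
  case (linear f)
  then show ?case
    by (intro exI[of _ "\<lambda>_. f b"] conjI real_polynomial_function.intros(2) allI exI[of _ f])
      (auto simp: bounded_linear_imp_has_derivative)
next
  case (const c)
  show ?case
    by (intro exI[of _ "\<lambda>_. 0"] conjI real_polynomial_function.intros(2) allI exI[of _ "\<lambda>_. 0"]) auto
next
  case (add f g)
  then obtain f' g' where *: "real_polynomial_function f'" "\<And>x. \<exists>D. (f has_derivative D) (at x) \<and> D b = f' x"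
    "real_polynomial_function g'" "\<And>x. \<exists>D. (g has_derivative D) (at x) \<and> D b = g' x" by blast
  have "\<exists>D. ((\<lambda>x. f x + g x) has_derivative D) (at x) \<and> D b = f' x + g' x" for x
  proof -
    obtain D E where "(f has_derivative D) (at x)" "D b = f' x" "(g has_derivative E) (at x)" "E b = g' x"
      using *(2)[of x] *(4)[of x] by blast
    then show ?thesis by (intro exI[of _ "\<lambda>h. D h + E h"]) (auto intro: has_derivative_add)
  qed
  then show ?case using * by (intro exI[of _ "\<lambda>x. f' x + g' x"]) (auto intro: real_polynomial_function.intros(3))
next
  case (mult f g)
  then obtain f' g' where *: "real_polynomial_function f'" "\<And>x. \<exists>D. (f has_derivative D) (at x) \<and> D b = f' x"
    "real_polynomial_function g'" "\<And>x. \<exists>D. (g has_derivative D) (at x) \<and> D b = g' x" by blast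
  have "\<exists>D. ((\<lambda>x. f x * g x) has_derivative D) (at x) \<and> D b = f x * g' x + f' x * g x" for x
  proof -
    obtain D E where "(f has_derivative D) (at x)" "D b = f' x" "(g has_derivative E) (at x)" "E b = g' x"
      using *(2)[of x] *(4)[of x] by blast
    then show ?thesis by (intro exI[of _ "\<lambda>h. f x * E h + D h * g x"]) (auto intro: has_derivative_mult)
  qed
  then show ?case using * mult.hyps
    by (intro exI[of _ "\<lambda>x. f x * g' x + f' x * g x"] conjI)
      (auto intro!: real_polynomial_function.intros(3,4))
qed

lemma real_polynomial_function_inner [simp, intro]: "real_polynomial_function (\<lambda>x. x \<bullet> b)"
  by (rule real_polynomial_function.intros(1)) (rule bounded_linear_inner_left)

definition gaussian_times :: "('a::euclidean_space \<Rightarrow> real) \<Rightarrow> 'a \<Rightarrow> complex" where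
  "gaussian_times p x = complex_of_real (p x * exp (- pi * (norm x)\<^sup>2))"

lemma partial_deriv_gaussian_times:
  assumes p: "real_polynomial_function p"
  obtains q where "real_polynomial_function q" "partial_deriv b (gaussian_times p) = gaussian_times q"
    "\<And>x. gaussian_times p differentiable (at x)"
proof -
  obtain q where q: "real_polynomial_function q" "\<And>x. \<exists>D. (p has_derivative D) (at x) \<and> D b = q x"
    using real_polynomial_function_directional_derivative[OF p] by blast
  have der: "\<exists>D. (gaussian_times p has_derivative D) (at x) \<and>
      D b = gaussian_times (\<lambda>x. q x + (- 2 * pi) * (x \<bullet> b) * p x) x" for x
  proof -
    obtain D where D: "(p has_derivative D) (at x)" "D b = q x" using q(2) by blast
    have "((\<lambda>x. complex_of_real (p x * exp (- pi * (x \<bullet> x)))) has_derivative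
       (\<lambda>h. complex_of_real (p x * (- pi * (x \<bullet> h + h \<bullet> x) * exp (- pi * (x \<bullet> x))) + D h * exp (- pi * (x \<bullet> x))))) (at x)"
      by (rule has_derivative_of_real derivative_eq_intros D refl)+
    then show ?thesis
      unfolding gaussian_times_def[abs_def] power2_norm_eq_inner
      by (intro exI conjI, assumption) (simp add: D inner_commute algebra_simps)
  qed
  show thesis
  proof
    show "real_polynomial_function (\<lambda>x. q x + (- 2 * pi) * (x \<bullet> b) * p x)"
      using p q(1) by (intro real_polynomial_function.intros(2-4)) auto
    show "partial_deriv b (gaussian_times p) = gaussian_times (\<lambda>x. q x + (- 2 * pi) * (x \<bullet> b) * p x)"
      unfolding partial_deriv_def using der frechet_derivative_at by (metis (no_types, lifting) ext)
    show "gaussian_times p differentiable (at x)" for x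
      using der differentiableI by blast
  qed
qed

lemma iterated_partial_deriv_gaussian_times:
  assumes p: "real_polynomial_function p"
  shows "\<exists>q. real_polynomial_function q \<and> foldr partial_deriv bs (gaussian_times p) = gaussian_times q"
proof (induction bs)
  case (Cons b bs)
  then obtain q where "real_polynomial_function q" "foldr partial_deriv bs (gaussian_times p) = gaussian_times q"
    by blast
  then show ?case using partial_deriv_gaussian_times[of q b] by (metis comp_apply foldr_Cons)
qed (use p in auto)

text \<open>All iterated partial derivatives are again polynomials times the Gaussian, and \<open>\<bar>x\<bar>\<^sup>k\<close> is dominated
  by the polynomial \<open>(1 + \<bar>x\<bar>\<^sup>2)\<^sup>k\<close>.\<close>

lemma schwartz_gaussian_times:
  fixes p :: "'a::euclidean_space \<Rightarrow> real"
  assumes p: "real_polynomial_function p"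
  shows "schwartz_function (gaussian_times p)"
  unfolding schwartz_function_def smooth_def
proof (intro conjI allI impI)
  fix bs :: "'a list" and x
  show "foldr partial_deriv bs (gaussian_times p) differentiable (at x)"
    using iterated_partial_deriv_gaussian_times[OF p, of bs] partial_deriv_gaussian_times by metis
next
  fix bs :: "'a list" and k :: nat
  obtain q where q: "real_polynomial_function q" "foldr partial_deriv bs (gaussian_times p) = gaussian_times q"
    using iterated_partial_deriv_gaussian_times[OF p] by blast
  have "real_polynomial_function (\<lambda>x::'a. (1 + (\<Sum>b\<in>Basis. (x \<bullet> b) * (x \<bullet> b))) ^ k * q x)"
    using q by (intro real_polynomial_function.intros(2-4) real_polynomial_function_power real_polynomial_function_sum) auto
  moreover have "(\<Sum>b\<in>Basis. (x \<bullet> b) * (x \<bullet> b)) = (norm x)\<^sup>2" for x :: 'a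
    unfolding norm_power2_eq_sum_Basis by (simp only: power2_eq_square)
  ultimately have "real_polynomial_function (\<lambda>x::'a. (1 + (norm x)\<^sup>2) ^ k * q x)" by simp
  then obtain B where B: "\<And>x. \<bar>(1 + (norm x)\<^sup>2) ^ k * q x\<bar> * exp (- pi * (norm x)\<^sup>2) \<le> B"
    using polynomial_gaussian_bounded[OF _ pi_gt_zero] by blast
  have "norm (norm x ^ k *\<^sub>R gaussian_times q x) \<le> B" for x
  proof -
    have "0 \<le> (norm x - 1 / 2)\<^sup>2" by simp
    then have "norm x \<le> 1 + (norm x)\<^sup>2" by (simp add: power2_eq_square algebra_simps)
    then have "norm x ^ k \<le> (1 + (norm x)\<^sup>2) ^ k" by (intro power_mono) auto
    then have "norm x ^ k * (\<bar>q x\<bar> * exp (- pi * (norm x)\<^sup>2)) \<le> (1 + (norm x)\<^sup>2) ^ k * (\<bar>q x\<bar> * exp (- pi * (norm x)\<^sup>2))"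
      by (intro mult_right_mono) auto
    also have "\<dots> \<le> B" using B[of x] by (simp add: abs_mult power_abs)
    finally show ?thesis by (simp add: gaussian_times_def norm_mult)
  qed
  then show "bounded (range (\<lambda>x. norm x ^ k *\<^sub>R foldr partial_deriv bs (gaussian_times p) x))"
    unfolding q(2) by (auto simp: bounded_iff)
qed

text \<open>Reduces partial derivatives of product functions to one-dimensional calculus along the line through \<open>x\<close>
  in direction \<open>b\<close>.\<close>

lemma partial_deriv_eq_vector_derivative:
  assumes "f differentiable (at x)" "((\<lambda>s. f (x + s *\<^sub>R b)) has_vector_derivative v) (at 0)"
  shows "partial_deriv b f x = v"
proof -
  define D where "D = frechet_derivative f (at x)"
  have D: "(f has_derivative D) (at x)" using assms(1) by (simp add: D_def frechet_derivative_works)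
  have "((\<lambda>s. x + s *\<^sub>R b) has_derivative (\<lambda>s. s *\<^sub>R b)) (at 0)"
    by (auto intro!: derivative_eq_intros)
  from has_derivative_compose[OF this, of f D] D
  have "((\<lambda>s. f (x + s *\<^sub>R b)) has_derivative (\<lambda>s. D (s *\<^sub>R b))) (at 0)" by simp
  also have "(\<lambda>s. D (s *\<^sub>R b)) = (\<lambda>s. s *\<^sub>R D b)"
    using has_derivative_bounded_linear[OF D] by (simp add: bounded_linear.linear linear_scale)
  finally have "((\<lambda>s. f (x + s *\<^sub>R b)) has_vector_derivative D b) (at 0)"
    by (simp add: has_vector_derivative_def)
  then show ?thesis
    using assms(2) vector_derivative_unique_at by (auto simp: partial_deriv_def D_def)
qed

section \<open>Hermite functions as eigenfunctions of the harmonic oscillator\<close>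

definition hermite_fun :: "('a::euclidean_space \<Rightarrow> nat) \<Rightarrow> 'a \<Rightarrow> real" where
  "hermite_fun \<kappa> x = (\<Prod>b\<in>Basis. hermite (\<kappa> b) (x \<bullet> b) / sqrt (hermite_sq_norm (\<kappa> b)))"

lemma hermite_fun_eq_gaussian_times:
  fixes \<kappa> :: "'a::euclidean_space \<Rightarrow> nat"
  obtains p where "real_polynomial_function p" "(\<lambda>x. complex_of_real (hermite_fun \<kappa> x)) = gaussian_times p"
proof
  let ?p = "\<lambda>x::'a. \<Prod>b\<in>Basis. (1 / sqrt (hermite_sq_norm (\<kappa> b))) * hermite_poly (\<kappa> b) (x \<bullet> b)"
  have "real_polynomial_function (\<lambda>x::'a. hermite_poly (\<kappa> b) (x \<bullet> b))" for b
    using real_polynomial_function_compose[of "\<lambda>x::'a. x \<bullet> b" "hermite_poly (\<kappa> b)"]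
    by (simp add: real_polynomial_function_eq[symmetric] comp_def)
  then show "real_polynomial_function ?p"
    by (intro real_polynomial_function_prod real_polynomial_function.intros(2-4)) auto
  have "(\<Prod>b\<in>Basis. exp (- pi * (x \<bullet> b)\<^sup>2)) = exp (- pi * (norm x)\<^sup>2)" for x :: 'a
    by (simp add: norm_power2_eq_sum_Basis exp_sum[symmetric] sum_distrib_left sum_negf)
  then have "hermite_fun \<kappa> x = ?p x * exp (- pi * (norm x)\<^sup>2)" for x
    unfolding hermite_fun_def hermite_def by (simp add: prod.distrib prod_dividef)
  then show "(\<lambda>x. complex_of_real (hermite_fun \<kappa> x)) = gaussian_times ?p"
    by (simp only: gaussian_times_def[abs_def])
qed

lemma schwartz_hermite_fun: "schwartz_function (\<lambda>x. complex_of_real (hermite_fun \<kappa> x))"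
  using hermite_fun_eq_gaussian_times[of \<kappa>] schwartz_gaussian_times by metis

lemma hermite_fun_measurable [measurable]: "hermite_fun \<kappa> \<in> borel_measurable borel"
proof -
  have "continuous_on UNIV (hermite n)" for n
    by (intro continuous_at_imp_continuous_on ballI DERIV_isCont[OF hermite_deriv])
  then have [measurable]: "hermite n \<in> borel_measurable borel" for n
    by (rule borel_measurable_continuous_onI)
  show ?thesis unfolding hermite_fun_def[abs_def] by measurable
qed

lemma partial_deriv_hermite_fun:
  fixes \<kappa> :: "'a::euclidean_space \<Rightarrow> nat"
  assumes b: "b \<in> Basis"
  shows "partial_deriv b (partial_deriv b (\<lambda>x. complex_of_real (hermite_fun \<kappa> x))) x
    = complex_of_real ((4 * pi\<^sup>2 * (x \<bullet> b)\<^sup>2 - 2 * pi * (2 * real (\<kappa> b) + 1)) * hermite_fun \<kappa> x)"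
proof -
  define f where "f x = complex_of_real (hermite_fun \<kappa> x)" for x
  define n where "n = \<kappa> b"
  define rest where "rest x = (\<Prod>c\<in>Basis - {b}. hermite (\<kappa> c) (x \<bullet> c) / sqrt (hermite_sq_norm (\<kappa> c))) / sqrt (hermite_sq_norm n)" for x
  have rest: "rest (x + s *\<^sub>R b) = rest x" for x s
    unfolding rest_def using b
    by (intro arg_cong2[where f = "(/)"] prod.cong refl) (auto simp: inner_add_left inner_not_same_Basis)
  have inner: "(x + s *\<^sub>R b) \<bullet> b = x \<bullet> b + s" for x s
    using b by (simp add: inner_add_left)
  have fun_eq: "hermite_fun \<kappa> x = hermite n (x \<bullet> b) * rest x" for x
    unfolding hermite_fun_def rest_def n_def by (subst prod.remove[OF _ b]) auto
  have sm: "foldr partial_deriv bs f differentiable (at x)" if "set bs \<subseteq> Basis" for bs x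
    using schwartz_hermite_fun[of \<kappa>] that unfolding schwartz_function_def smooth_def f_def[abs_def] by blast
  have line: "((\<lambda>s. complex_of_real (\<phi> ((x + s *\<^sub>R b) \<bullet> b) * rest (x + s *\<^sub>R b))) has_vector_derivative complex_of_real (\<phi>' * rest x)) (at 0)"
    if "(\<phi> has_real_derivative \<phi>') (at (x \<bullet> b))" for \<phi> \<phi>' x
  proof -
    have "((\<lambda>s. \<phi> (x \<bullet> b + s)) has_real_derivative \<phi>') (at 0)"
      using that DERIV_shift[of \<phi> \<phi>' 0 "x \<bullet> b"] by (simp add: add.commute)
    then have "((\<lambda>s. \<phi> (x \<bullet> b + s) * rest x) has_real_derivative \<phi>' * rest x) (at 0)"
      by (rule DERIV_cmult_right)
    then show ?thesis
      unfolding inner rest by (intro has_vector_derivative_of_real) (simp add: has_real_derivative_iff_has_vector_derivative)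
  qed
  define \<phi>' where "\<phi>' s = 4 * pi * n * hermite (n - 1) s - 2 * pi * s * hermite n s" for s
  have first: "partial_deriv b f = (\<lambda>x. complex_of_real (\<phi>' (x \<bullet> b) * rest x))"
  proof
    fix x
    show "partial_deriv b f x = complex_of_real (\<phi>' (x \<bullet> b) * rest x)"
      using sm[of "[]"] line[OF hermite_deriv[of n], folded \<phi>'_def]
      by (intro partial_deriv_eq_vector_derivative) (auto simp: f_def fun_eq)
  qed
  have "partial_deriv b (partial_deriv b f) x
      = complex_of_real ((4 * pi\<^sup>2 * (x \<bullet> b)\<^sup>2 - 2 * pi * (2 * real n + 1)) * hermite n (x \<bullet> b) * rest x)"
  proof (rule partial_deriv_eq_vector_derivative)
    show "partial_deriv b f differentiable (at x)" using sm[of "[b]"] b by simp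
    show "((\<lambda>s. partial_deriv b f (x + s *\<^sub>R b)) has_vector_derivative
      complex_of_real ((4 * pi\<^sup>2 * (x \<bullet> b)\<^sup>2 - 2 * pi * (2 * real n + 1)) * hermite n (x \<bullet> b) * rest x)) (at 0)"
      unfolding first by (rule line) (use hermite_deriv2[of n] in \<open>simp add: \<phi>'_def[abs_def]\<close>)
  qed
  then show ?thesis unfolding f_def[abs_def] by (simp add: fun_eq n_def mult.assoc)
qed

text \<open>The terms \<open>\<pi> \<bar>x\<bar>\<^sup>2\<close> from the second derivatives and from the potential cancel.\<close>

lemma harmonic_oscillator_hermite_fun:
  fixes \<kappa> :: "'a::euclidean_space \<Rightarrow> nat"
  shows "harmonic_oscillator (\<lambda>x. complex_of_real (hermite_fun \<kappa> x)) x
    = complex_of_real (\<Sum>b\<in>(Basis :: 'a set). real (\<kappa> b) + 1 / 2) * complex_of_real (hermite_fun \<kappa> x)"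
proof -
  have "- (1 / (4 * pi)) * (\<Sum>b\<in>Basis. 4 * pi\<^sup>2 * (x \<bullet> b)\<^sup>2 - 2 * pi * (2 * real (\<kappa> b) + 1))
      = (\<Sum>b\<in>Basis. - (1 / (4 * pi)) * (4 * pi\<^sup>2 * (x \<bullet> b)\<^sup>2 - 2 * pi * (2 * real (\<kappa> b) + 1)))"
    by (simp only: sum_distrib_left)
  also have "\<dots> = (\<Sum>b\<in>Basis. - pi * (x \<bullet> b)\<^sup>2 + (real (\<kappa> b) + 1 / 2))"
    by (intro sum.cong refl) (simp add: field_simps power2_eq_square)
  also have "\<dots> = - pi * (norm x)\<^sup>2 + (\<Sum>b\<in>(Basis :: 'a set). real (\<kappa> b) + 1 / 2)"
    by (simp only: sum.distrib sum_distrib_left[symmetric] norm_power2_eq_sum_Basis[symmetric])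
  finally have key: "- (1 / (4 * pi)) * (\<Sum>b\<in>Basis. 4 * pi\<^sup>2 * (x \<bullet> b)\<^sup>2 - 2 * pi * (2 * real (\<kappa> b) + 1)) + pi * (norm x)\<^sup>2
      = (\<Sum>b\<in>(Basis :: 'a set). real (\<kappa> b) + 1 / 2)" by simp
  have lap: "laplacian (\<lambda>x. complex_of_real (hermite_fun \<kappa> x)) x
      = complex_of_real (\<Sum>b\<in>Basis. 4 * pi\<^sup>2 * (x \<bullet> b)\<^sup>2 - 2 * pi * (2 * real (\<kappa> b) + 1)) * complex_of_real (hermite_fun \<kappa> x)"
    unfolding laplacian_def by (simp add: partial_deriv_hermite_fun sum_distrib_right)
  have "harmonic_oscillator (\<lambda>x. complex_of_real (hermite_fun \<kappa> x)) x
      = complex_of_real (- (1 / (4 * pi)) * (\<Sum>b\<in>Basis. 4 * pi\<^sup>2 * (x \<bullet> b)\<^sup>2 - 2 * pi * (2 * real (\<kappa> b) + 1)) + pi * (norm x)\<^sup>2)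
        * complex_of_real (hermite_fun \<kappa> x)"
    unfolding harmonic_oscillator_def lap of_real_add of_real_mult of_real_minus distrib_right by (simp only: mult.assoc mult_minus_left)
  then show ?thesis unfolding key .
qed

lemma integral_lborel_prod_hermite:
  fixes \<kappa> \<kappa>' :: "'a::euclidean_space \<Rightarrow> nat"
  assumes w: "\<And>b. b \<in> Basis \<Longrightarrow> real_polynomial_function (w b)"
  shows "integrable lborel (\<lambda>x::'a. (\<Prod>b\<in>Basis. w b (x \<bullet> b)) * (hermite_fun \<kappa> x * hermite_fun \<kappa>' x))"
    and "(\<integral>x. (\<Prod>b\<in>Basis. w b (x \<bullet> b)) * (hermite_fun \<kappa> x * hermite_fun \<kappa>' x) \<partial>lborel)
      = (\<Prod>b\<in>Basis. (\<integral>s. w b s * (hermite (\<kappa> b) s * hermite (\<kappa>' b) s) \<partial>lborel)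
           / (sqrt (hermite_sq_norm (\<kappa> b)) * sqrt (hermite_sq_norm (\<kappa>' b))))"
proof -
  define F where "F b s = w b s * (hermite (\<kappa> b) s * hermite (\<kappa>' b) s) / (sqrt (hermite_sq_norm (\<kappa> b)) * sqrt (hermite_sq_norm (\<kappa>' b)))" for b s
  have F: "integrable lborel (F b)" if "b \<in> Basis" for b
    unfolding F_def by (intro integrable_divide hermite_poly_gaussian_integrable w that)
  have eq: "(\<Prod>b\<in>Basis. w b (x \<bullet> b)) * (hermite_fun \<kappa> x * hermite_fun \<kappa>' x) = (\<Prod>b\<in>Basis. F b (x \<bullet> b))" for x
    by (simp add: hermite_fun_def F_def prod.distrib[symmetric])
  show "integrable lborel (\<lambda>x::'a. (\<Prod>b\<in>Basis. w b (x \<bullet> b)) * (hermite_fun \<kappa> x * hermite_fun \<kappa>' x))"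
    unfolding eq by (rule integrable_lborel_prod[OF F])
  show "(\<integral>x. (\<Prod>b\<in>Basis. w b (x \<bullet> b)) * (hermite_fun \<kappa> x * hermite_fun \<kappa>' x) \<partial>lborel)
      = (\<Prod>b\<in>Basis. (\<integral>s. w b s * (hermite (\<kappa> b) s * hermite (\<kappa>' b) s) \<partial>lborel)
           / (sqrt (hermite_sq_norm (\<kappa> b)) * sqrt (hermite_sq_norm (\<kappa>' b))))"
    unfolding eq by (subst integral_lborel_prod[OF F]) (simp_all add: F_def[abs_def])
qed

lemma
  fixes \<kappa> \<kappa>' :: "'a::euclidean_space \<Rightarrow> nat"
  shows hermite_fun_integrable: "integrable lborel (\<lambda>x. hermite_fun \<kappa> x * hermite_fun \<kappa>' x)"
    and hermite_fun_orthonormal: "(\<integral>x. hermite_fun \<kappa> x * hermite_fun \<kappa>' x \<partial>lborel)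
      = (if \<forall>b\<in>Basis. \<kappa> b = \<kappa>' b then 1 else 0)"
proof -
  note * = integral_lborel_prod_hermite[of "\<lambda>_ _. 1" \<kappa> \<kappa>', OF real_polynomial_function.intros(2)]
  show "integrable lborel (\<lambda>x. hermite_fun \<kappa> x * hermite_fun \<kappa>' x)" using *(1) by simp
  have "(\<integral>s. hermite n s * hermite m s \<partial>lborel) / (sqrt (hermite_sq_norm n) * sqrt (hermite_sq_norm m))
      = (if n = m then 1 else 0)" for n m
    using hermite_sq_norm_pos[of n] by (auto simp: hermite_orthogonal)
  then have "(\<integral>x. hermite_fun \<kappa> x * hermite_fun \<kappa>' x \<partial>lborel) = (\<Prod>b\<in>Basis. if \<kappa> b = \<kappa>' b then 1 else 0)"
    using *(2) by simp
  then show "(\<integral>x. hermite_fun \<kappa> x * hermite_fun \<kappa>' x \<partial>lborel) = (if \<forall>b\<in>Basis. \<kappa> b = \<kappa>' b then 1 else 0)"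
    by auto
qed

text \<open>The second moment is the energy up to the factor \<open>2 \<pi>\<close>. The weight \<open>\<bar>x\<bar>\<^sup>2\<close> is a sum over \<open>c\<close> of product
  functions whose factors are \<open>s\<^sup>2\<close> in the coordinate \<open>c\<close> and \<open>1\<close> in the others.\<close>

lemma
  fixes \<kappa> :: "'a::euclidean_space \<Rightarrow> nat"
  shows hermite_fun_moment_integrable: "integrable lborel (\<lambda>x. (norm x)\<^sup>2 * (hermite_fun \<kappa> x * hermite_fun \<kappa> x))"
    and hermite_fun_moment: "(\<integral>x. (norm x)\<^sup>2 * (hermite_fun \<kappa> x * hermite_fun \<kappa> x) \<partial>lborel)
      = (\<Sum>b\<in>(Basis :: 'a set). (2 * real (\<kappa> b) + 1) / (4 * pi))"
proof -
  define w where "w c b s = (if b = c then s\<^sup>2 else (1::real))" for c b :: 'a and s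
  have w: "real_polynomial_function (w c b)" for c b
    by (cases "b = c") (auto simp: w_def[abs_def] intro: real_polynomial_function.intros(2) real_polynomial_function_power)
  have "(norm x)\<^sup>2 = (\<Sum>c\<in>Basis. \<Prod>b\<in>Basis. w c b (x \<bullet> b))" for x
    unfolding norm_power2_eq_sum_Basis by (intro sum.cong refl) (simp add: w_def)
  then have eq: "(norm x)\<^sup>2 * (hermite_fun \<kappa> x * hermite_fun \<kappa> x)
      = (\<Sum>c\<in>Basis. (\<Prod>b\<in>Basis. w c b (x \<bullet> b)) * (hermite_fun \<kappa> x * hermite_fun \<kappa> x))" for x
    by (simp add: sum_distrib_right)
  note * = integral_lborel_prod_hermite[of "w _" \<kappa> \<kappa>, OF w]
  show "integrable lborel (\<lambda>x. (norm x)\<^sup>2 * (hermite_fun \<kappa> x * hermite_fun \<kappa> x))"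
    unfolding eq by (intro Bochner_Integration.integrable_sum *(1))
  have one: "(\<integral>s. w c b s * (hermite (\<kappa> b) s * hermite (\<kappa> b) s) \<partial>lborel)
      / (sqrt (hermite_sq_norm (\<kappa> b)) * sqrt (hermite_sq_norm (\<kappa> b)))
      = (if b = c then (2 * real (\<kappa> b) + 1) / (4 * pi) else 1)" for b c
    using hermite_sq_norm_pos[of "\<kappa> b"] hermite_sq_norm_pos[of "\<kappa> c"] by (simp add: w_def hermite_second_moment hermite_sq_norm_def[symmetric])
  have "(\<integral>x. (norm x)\<^sup>2 * (hermite_fun \<kappa> x * hermite_fun \<kappa> x) \<partial>lborel)
      = (\<Sum>c\<in>(Basis :: 'a set). \<Prod>b\<in>Basis. if b = c then (2 * real (\<kappa> b) + 1) / (4 * pi) else 1)"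
    unfolding eq by (subst Bochner_Integration.integral_sum) (simp_all only: * one)
  also have "\<dots> = (\<Sum>c\<in>(Basis :: 'a set). (2 * real (\<kappa> c) + 1) / (4 * pi))"
    by (intro sum.cong refl) (simp add: prod.delta)
  finally show "(\<integral>x. (norm x)\<^sup>2 * (hermite_fun \<kappa> x * hermite_fun \<kappa> x) \<partial>lborel)
      = (\<Sum>b\<in>(Basis :: 'a set). (2 * real (\<kappa> b) + 1) / (4 * pi))" .
qed

section \<open>Finite-rank projections\<close>

lemma spectral_form_projection:
  assumes f: "L2_orthonormal f" and S: "finite S"
  shows "spectral_form (\<lambda>u x. \<Sum>j\<in>S. L2_inner (f j) u * f j x) (indicator S) f"
  unfolding spectral_form_def
proof (intro conjI ballI f)
  fix u :: "'a \<Rightarrow> complex"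
  show "(\<lambda>x. \<Sum>j\<in>S. L2_inner (f j) u * f j x) \<in> L2"
    using f by (intro L2_sum S) (auto simp: L2_orthonormal_def)
  have "\<forall>\<^sub>F n in sequentially. S \<subseteq> {..<n}"
    using S by (metis eventually_sequentiallyI finite_nat_iff_bounded lessThan_subset_iff subset_trans)
  then have "\<forall>\<^sub>F n in sequentially. L2_norm (\<lambda>x. (\<Sum>j\<in>S. L2_inner (f j) u * f j x)
      - (\<Sum>j<n. indicator S j * L2_inner (f j) u * f j x)) = 0"
  proof eventually_elim
    case (elim n)
    have "(\<Sum>j<n. indicator S j * L2_inner (f j) u * f j x) = (\<Sum>j\<in>S. L2_inner (f j) u * f j x)" for x
      using elim by (intro sum.mono_neutral_cong_right) (auto simp: indicator_def)
    then show ?case by (simp add: L2_norm_eq sq_norm_def ennreal_powr_def)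
  qed
  then show "(\<lambda>n. L2_norm (\<lambda>x. (\<Sum>j\<in>S. L2_inner (f j) u * f j x)
      - (\<Sum>j<n. indicator S j * L2_inner (f j) u * f j x))) \<longlonglongrightarrow> 0"
    by (rule tendsto_eventually)
qed

lemma operator_nonzero_projection:
  assumes f: "L2_orthonormal f" and S: "finite S" "S \<noteq> {}"
  shows "operator_nonzero (\<lambda>u x. \<Sum>j\<in>S. L2_inner (f j) u * f j x)"
proof -
  obtain i where i: "i \<in> S" using S by blast
  have fi: "f i \<in> L2" "L2_inner (f j) (f i) = (if j = i then 1 else 0)" for j
    using f by (auto simp: L2_orthonormal_def)
  have eq: "(\<Sum>j\<in>S. L2_inner (f j) (f i) * f j x) = f i x" for x
    using S i by (simp add: fi(2) if_distrib[of "\<lambda>c. c * _"] sum.delta cong: if_cong)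
  have "\<not> (AE x in lborel. f i x = 0)"
  proof
    assume "AE x in lborel. f i x = 0"
    then have "L2_inner (f i) (f i) = 0"
      unfolding L2_inner_def by (intro integral_eq_zero_AE) auto
    then show False by (simp add: fi(2))
  qed
  then show ?thesis unfolding operator_nonzero_def using fi(1) by (intro bexI[of _ "f i"]) (auto simp: eq)
qed

lemma schatten_norm_indicator:
  assumes S: "finite S" "S \<noteq> {}"
  shows "schatten_norm r (indicator S) = ennreal (real (card S) powr enn2real (inverse r))"
proof (cases "r = \<infinity>")
  case True
  have "Inf {c. \<forall>j. ennreal (cmod (indicator S j)) \<le> c} = 1"
  proof (rule antisym)
    show "Inf {c. \<forall>j. ennreal (cmod (indicator S j)) \<le> c} \<le> 1"
      by (intro Inf_lower) (auto simp: indicator_def)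
    obtain i where "i \<in> S" using S by blast
    then show "1 \<le> Inf {c. \<forall>j. ennreal (cmod (indicator S j)) \<le> c}"
      by (intro Inf_greatest) (auto dest!: spec[of _ i])
  qed
  then show ?thesis using True S by (simp add: schatten_norm_def Lp_norm_def AE_count_space)
next
  case False
  have "ennreal_powr (ennreal (cmod (indicator S j))) b = indicator S j" for j b
    by (simp add: ennreal_powr_def indicator_def)
  then have "schatten_norm r (indicator S) = ennreal_powr (of_nat (card S)) (1 / enn2real r)"
    using False S by (simp add: schatten_norm_def Lp_norm_def)
  also have "\<dots> = ennreal (real (card S) powr (1 / enn2real r))"
    by (simp add: ennreal_of_nat_eq_real_of_nat ennreal_powr_ennreal)
  also have "1 / enn2real r = enn2real (inverse r)"
  proof (cases "r = 0")
    case r0: False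
    obtain x where "r = ennreal x" "x > 0" using False r0 by (cases r) auto
    then show ?thesis by (simp add: inverse_ennreal inverse_eq_divide)
  qed simp
  finally show ?thesis .
qed

lemma schatten_coefficients_indicator:
  assumes "finite S" "S \<noteq> {}"
  shows "schatten_coefficients r (indicator S)"
  unfolding schatten_coefficients_def
proof
  have "\<forall>\<^sub>F n in sequentially. S \<subseteq> {..<n}"
    using assms(1) by (metis eventually_sequentiallyI finite_nat_iff_bounded lessThan_subset_iff subset_trans)
  then have "\<forall>\<^sub>F n in sequentially. indicator S n = (0 :: complex)"
    by eventually_elim (auto simp: indicator_def)
  then show "(indicator S :: nat \<Rightarrow> complex) \<longlonglongrightarrow> 0" by (rule tendsto_eventually)
qed (simp add: schatten_norm_indicator assms)

lemma density_defined_indicator: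
  assumes U: "unitary_group U" and f: "\<And>j. f j \<in> L2" and S: "finite S"
  shows "density_defined U I (indicator S) f"
  unfolding density_defined_def
proof (intro AE_I2 allI impI)
  fix t and K :: "'a set"
  have UL2: "U t (f j) \<in> L2" for j using U f by (auto simp: unitary_group_def)
  note [measurable] = UL2[THEN L2_measurable]
  have eq: "(\<Sum>j. ennreal (cmod (indicator S j) * (cmod (U t (f j) x))\<^sup>2))
      = (\<Sum>j\<in>S. ennreal ((cmod (U t (f j) x))\<^sup>2))" for x
    by (subst suminf_finite[OF S]) (auto simp: indicator_def)
  have "(\<integral>\<^sup>+x\<in>K. (\<Sum>j. ennreal (cmod (indicator S j) * (cmod (U t (f j) x))\<^sup>2)) \<partial>lborel)
      \<le> (\<integral>\<^sup>+x. (\<Sum>j\<in>S. ennreal ((cmod (U t (f j) x))\<^sup>2)) \<partial>lborel)"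
    unfolding eq
  proof (rule nn_integral_mono)
    show "z * indicator K x \<le> z" for z :: ennreal and x
      by (cases "x \<in> K") simp_all
  qed
  also have "\<dots> = (\<Sum>j\<in>S. sq_norm (U t (f j)))"
    unfolding sq_norm_def by (rule nn_integral_sum) measurable
  also have "\<dots> < \<infinity>" using UL2 S by (simp add: L2_iff)
  finally show "(\<integral>\<^sup>+x\<in>K. (\<Sum>j. ennreal (cmod (indicator S j) * (cmod (U t (f j) x))\<^sup>2)) \<partial>lborel) < \<infinity>" .
qed

lemma wiener_norm_cong_AE:
  assumes [measurable]: "F \<in> borel_measurable borel" "G \<in> borel_measurable borel" "g \<in> borel_measurable borel"
    and eq: "AE x in lborel. F x = G x"
  shows "wiener_norm g a b F = wiener_norm g a b G"
proof -
  have "fourier (\<lambda>y. F y * translate x g y) = fourier (\<lambda>y. G y * translate x g y)" for x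
    unfolding fourier_def translate_def
    by (intro ext integral_cong_AE) (use eq in \<open>auto\<close>)
  then show ?thesis by (simp add: wiener_norm_def fourier_Lp_norm_def)
qed

section \<open>Spectral projections of the harmonic oscillator\<close>

lemma hermite_fun_L2: "(\<lambda>x. complex_of_real (hermite_fun \<kappa> x)) \<in> L2"
proof -
  have "sq_norm (\<lambda>x. complex_of_real (hermite_fun \<kappa> x)) = (\<integral>\<^sup>+x. ennreal (hermite_fun \<kappa> x * hermite_fun \<kappa> x) \<partial>lborel)"
    by (simp add: sq_norm_def power2_eq_square)
  also have "\<dots> = ennreal (\<integral>x. hermite_fun \<kappa> x * hermite_fun \<kappa> x \<partial>lborel)"
    by (intro nn_integral_eq_integral hermite_fun_integrable) auto
  finally show ?thesis by (simp add: L2_iff)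
qed

text \<open>The evolution multiplies an eigenfunction by a phase, so its density does not move.\<close>

lemma hermite_fun_evolution:
  fixes \<kappa> :: "'a::euclidean_space \<Rightarrow> nat"
  assumes "generates_unitary_group harmonic_oscillator U"
  shows "AE x in lborel. cmod (U t (\<lambda>x. complex_of_real (hermite_fun \<kappa> x)) x) = \<bar>hermite_fun \<kappa> x\<bar>"
  using eigenfunction_evolution[OF assms schwartz_hermite_fun[of \<kappa>] hermite_fun_L2[of \<kappa>]
      harmonic_oscillator_hermite_fun[of \<kappa>], of t]
  by eventually_elim (simp add: norm_mult)

lemma enumerate_multi_indices:
  obtains e :: "nat \<Rightarrow> 'a::euclidean_space \<Rightarrow> nat"
  where "bij_betw e UNIV (PiE Basis (\<lambda>_. UNIV))"
proof -
  have "countable (PiE (Basis :: 'a set) (\<lambda>_. UNIV :: nat set))"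
    by (intro countable_PiE) auto
  moreover have "infinite (PiE (Basis :: 'a set) (\<lambda>_. UNIV :: nat set))"
    by (subst finite_PiE_iff) (auto simp: PiE_eq_empty_iff)
  ultimately show thesis using that bij_betw_from_nat_into by blast
qed

text \<open>Take the projection onto the Hermite functions whose indices are all below \<open>m\<close>. Its rank is
  \<open>N = m\<^sup>d\<close>, its density is stationary, and its second moment is at most \<open>d m N\<close>, so the density
  lives at scale \<open>\<sigma> = (d m)\<^bsup>1/2\<^esup>\<close>. The ratio is therefore at least a constant times
  \<open>m\<^bsup>d + d (1/p - 1) / 2 - d / r\<^esup>\<close>.\<close>

lemma hermite_projection_ratio:
  fixes g :: "'a::euclidean_space \<Rightarrow> complex" and U :: "real \<Rightarrow> ('a \<Rightarrow> complex) \<Rightarrow> 'a \<Rightarrow> complex"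
  assumes gen: "generates_unitary_group harmonic_oscillator U"
    and g: "test_function g" "g \<noteq> (\<lambda>_. 0)"
    and a: "1 \<le> a" and p: "1 \<le> p" and q: "0 < q"
    and I: "I \<in> sets lborel" "1 \<le> emeasure lborel I"
  obtains C where "C > 0"
    and "\<And>m. m > 0 \<Longrightarrow> \<exists>\<gamma> \<alpha> f. spectral_form \<gamma> \<alpha> f \<and> schatten_coefficients r \<alpha> \<and> operator_nonzero \<gamma> \<and>
        density_defined U I \<alpha> f \<and>
        ennreal (C * real m powr (real DIM('a) * ((1 + enn2real (inverse p)) / 2 - enn2real (inverse r))))
          \<le> mixed_wiener_norm g q I a p (evolved_density U \<alpha> f) / schatten_norm r \<alpha>"
proof -
  have U: "unitary_group U" using gen by (simp add: generates_unitary_group_def)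
  obtain K where K: "compact K" "\<And>x. x \<notin> K \<Longrightarrow> g x = 0"
    using g by (auto simp: test_function_def)
  have "g differentiable (at x)" for x
    using g by (auto simp: test_function_def smooth_def dest!: spec[of _ "[]"])
  then have g_cont: "continuous_on UNIV g"
    by (intro continuous_at_imp_continuous_on ballI differentiable_imp_continuous_within)
  then have [measurable]: "g \<in> borel_measurable borel" by (rule borel_measurable_continuous_onI)
  define d where "d = DIM('a)"
  have d: "d > 0" by (simp add: d_def)
  define \<theta> where "\<theta> = enn2real (inverse p)"
  obtain C where C: "C > 0"
    and lower: "\<And>\<rho> \<sigma>. \<lbrakk>integrable lborel \<rho>; \<And>y. 0 \<le> \<rho> y; integrable lborel (\<lambda>y. (norm y)\<^sup>2 * \<rho> y); 1 \<le> \<sigma>;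
        (\<integral>y. (norm y)\<^sup>2 * \<rho> y \<partial>lborel) \<le> \<sigma>\<^sup>2 * (\<integral>y. \<rho> y \<partial>lborel)\<rbrakk> \<Longrightarrow>
        ennreal (C * (\<integral>y. \<rho> y \<partial>lborel) * \<sigma> powr (real d * (\<theta> - 1)))
          \<le> wiener_norm g a p (\<lambda>y. complex_of_real (\<rho> y))"
    unfolding d_def \<theta>_def using wiener_norm_lower_bound[OF g_cont g(2) K a p] by blast
  obtain e :: "nat \<Rightarrow> 'a \<Rightarrow> nat" where e: "bij_betw e UNIV (PiE Basis (\<lambda>_. UNIV))"
    using enumerate_multi_indices by blast
  define f where "f j x = complex_of_real (hermite_fun (e j) x)" for j x
  have fL2: "f j \<in> L2" for j unfolding f_def[abs_def] by (rule hermite_fun_L2)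
  have e_eq: "(\<forall>b\<in>Basis. e j b = e k b) \<longleftrightarrow> j = k" for j k
  proof
    assume "\<forall>b\<in>Basis. e j b = e k b"
    moreover have "e i \<in> PiE Basis (\<lambda>_. UNIV)" for i using e by (auto simp: bij_betw_def)
    ultimately have "e j = e k" using PiE_ext[of "e j" Basis "\<lambda>_. UNIV" "e k"] by blast
    then show "j = k" using e by (auto simp: bij_betw_def dest: injD)
  qed simp
  have f_orth: "L2_orthonormal f"
    unfolding L2_orthonormal_def
  proof (intro conjI allI fL2)
    fix j k
    have "L2_inner (f j) (f k) = complex_of_real (\<integral>x. hermite_fun (e j) x * hermite_fun (e k) x \<partial>lborel)"
      unfolding L2_inner_def f_def by (subst integral_complex_of_real[symmetric]) simp
    then show "L2_inner (f j) (f k) = (if j = k then 1 else 0)"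
      by (simp add: hermite_fun_orthonormal e_eq)
  qed
  have UfL2: "U t (f j) \<in> L2" for t j using U fL2 by (auto simp: unitary_group_def)
  note [measurable] = UfL2[THEN L2_measurable]
  define s where "s = enn2real (inverse r)"
  define C' where "C' = C * real d powr (real d * (\<theta> - 1) / 2)"
  show thesis
  proof
    show "C' > 0" using C d by (simp add: C'_def)
  next
    fix m :: nat assume m: "m > 0"
    define S where "S = e -` (PiE Basis (\<lambda>_. {..<m}))"
    have box: "PiE Basis (\<lambda>_. {..<m}) \<subseteq> range e"
      using e by (auto simp: bij_betw_def PiE_def)
    have fin_box: "finite (PiE (Basis :: 'a set) (\<lambda>_. {..<m}))" by (intro finite_PiE) auto
    have inj: "inj e" using e by (simp add: bij_betw_def)
    have S_fin: "finite S" unfolding S_def by (rule finite_vimageI[OF fin_box inj])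
    have S_card: "card S = m ^ d"
      unfolding S_def using card_vimage_inj[OF inj box] by (simp add: card_PiE d_def)
    have S_ne: "S \<noteq> {}" using S_card m by auto
    have S_less: "e j b < m" if "j \<in> S" "b \<in> Basis" for j b
      using that by (auto simp: S_def)
    define N where "N = real (card S)"
    have N: "N = real m ^ d" "N > 0" using S_card m by (auto simp: N_def)
    define \<rho> where "\<rho> x = (\<Sum>j\<in>S. hermite_fun (e j) x * hermite_fun (e j) x)" for x
    have \<rho>: "integrable lborel \<rho>" "\<And>x. 0 \<le> \<rho> x"
      unfolding \<rho>_def by (auto intro!: Bochner_Integration.integrable_sum hermite_fun_integrable sum_nonneg)
    have \<rho>_int: "(\<integral>x. \<rho> x \<partial>lborel) = N"
      unfolding \<rho>_def by (simp add: Bochner_Integration.integral_sum hermite_fun_integrable hermite_fun_orthonormal N_def)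
    have \<rho>_mom: "(norm x)\<^sup>2 * \<rho> x = (\<Sum>j\<in>S. (norm x)\<^sup>2 * (hermite_fun (e j) x * hermite_fun (e j) x))" for x
      by (simp add: \<rho>_def sum_distrib_left)
    have \<rho>_mom_int: "integrable lborel (\<lambda>x. (norm x)\<^sup>2 * \<rho> x)"
      unfolding \<rho>_mom by (intro Bochner_Integration.integrable_sum hermite_fun_moment_integrable)
    \<comment> \<open>Each coordinate direction contributes at most \<open>m\<close> to the second moment of each function.\<close>
    define \<sigma> where "\<sigma> = sqrt (real d * real m)"
    have dm: "1 \<le> real d * real m" using d m by (metis One_nat_def Suc_leI nat_0_less_mult_iff of_nat_1 of_nat_le_iff of_nat_mult)
    then have \<sigma>: "1 \<le> \<sigma>" "\<sigma>\<^sup>2 = real d * real m" by (auto simp: \<sigma>_def)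
    have "(\<integral>x. (norm x)\<^sup>2 * \<rho> x \<partial>lborel) = (\<Sum>j\<in>S. \<Sum>b\<in>(Basis :: 'a set). (2 * real (e j b) + 1) / (4 * pi))"
      unfolding \<rho>_mom by (simp add: Bochner_Integration.integral_sum hermite_fun_moment_integrable hermite_fun_moment)
    also have "\<dots> \<le> (\<Sum>j\<in>S. \<Sum>b\<in>(Basis :: 'a set). real m)"
    proof (intro sum_mono)
      fix j b assume "j \<in> S" "b \<in> (Basis :: 'a set)"
      then have "e j b < m" by (rule S_less)
      then have "2 * real (e j b) + 1 \<le> 2 * real m" by linarith
      also have "\<dots> \<le> real m * (4 * pi)" using pi_gt3 m by simp
      finally show "(2 * real (e j b) + 1) / (4 * pi) \<le> real m" by (simp add: pos_divide_le_eq)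
    qed
    also have "\<dots> = \<sigma>\<^sup>2 * (\<integral>x. \<rho> x \<partial>lborel)"
      by (simp add: \<rho>_int N_def \<sigma> d_def)
    finally have mom_le: "(\<integral>x. (norm x)\<^sup>2 * \<rho> x \<partial>lborel) \<le> \<sigma>\<^sup>2 * (\<integral>x. \<rho> x \<partial>lborel)" .
    define W where "W = wiener_norm g a p (\<lambda>y. complex_of_real (\<rho> y))"
    have W: "ennreal (C * N * \<sigma> powr (real d * (\<theta> - 1))) \<le> W"
      unfolding W_def using lower[OF \<rho> \<rho>_mom_int \<sigma>(1) mom_le] by (simp add: \<rho>_int)

    have dens: "evolved_density U (indicator S) f t x = complex_of_real (\<Sum>j\<in>S. (cmod (U t (f j) x))\<^sup>2)" for t x
      unfolding evolved_density_def by (subst suminf_finite[OF S_fin]) (auto simp: indicator_def)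
    have stationary: "wiener_norm g a p (evolved_density U (indicator S) f t) = W" for t
      unfolding W_def
    proof (rule wiener_norm_cong_AE)
      show "evolved_density U (indicator S) f t \<in> borel_measurable borel"
        unfolding dens[abs_def] by measurable
      show "(\<lambda>y. complex_of_real (\<rho> y)) \<in> borel_measurable borel"
        unfolding \<rho>_def by measurable
      have "AE x in lborel. \<forall>j\<in>S. cmod (U t (f j) x) = \<bar>hermite_fun (e j) x\<bar>"
        unfolding f_def[abs_def]
        by (rule AE_finite_allI[OF S_fin]) (rule hermite_fun_evolution[OF gen])
      then show "AE x in lborel. evolved_density U (indicator S) f t x = complex_of_real (\<rho> x)"
        by eventually_elim (simp add: dens \<rho>_def power2_eq_square)
    qed measurable
    have "W \<le> mixed_wiener_norm g q I a p (evolved_density U (indicator S) f)"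
      unfolding mixed_wiener_norm_def stationary
      using I q by (intro Lp_norm_const_ge) (auto simp: emeasure_restrict_space space_restrict_space)
    with W have num: "ennreal (C * N * \<sigma> powr (real d * (\<theta> - 1)))
        \<le> mixed_wiener_norm g q I a p (evolved_density U (indicator S) f)" by (rule order_trans)
    have den: "schatten_norm r (indicator S) = ennreal (N powr s)"
      by (simp add: schatten_norm_indicator S_fin S_ne N_def s_def)
    have "C' * real m powr (real d * ((1 + \<theta>) / 2 - s)) = C * N * \<sigma> powr (real d * (\<theta> - 1)) / N powr s"
    proof -
      have m0: "real m > 0" using m by simp
      have "\<sigma> powr (real d * (\<theta> - 1)) = (real d * real m) powr (real d * (\<theta> - 1) / 2)"
        using dm by (simp add: \<sigma>_def powr_half_sqrt[symmetric] powr_powr)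
      also have "\<dots> = real d powr (real d * (\<theta> - 1) / 2) * real m powr (real d * (\<theta> - 1) / 2)"
        using d m by (simp add: powr_mult)
      finally have "C * N * \<sigma> powr (real d * (\<theta> - 1)) / N powr s
          = C' * (real m powr real d * real m powr (real d * (\<theta> - 1) / 2) / real m powr (real d * s))"
        using m0 by (simp add: C'_def N powr_realpow[symmetric] powr_powr)
      also have "real m powr real d * real m powr (real d * (\<theta> - 1) / 2) / real m powr (real d * s)
          = real m powr (real d + real d * (\<theta> - 1) / 2 - real d * s)"
        by (simp add: powr_add powr_diff)
      also have "real d + real d * (\<theta> - 1) / 2 - real d * s = real d * ((1 + \<theta>) / 2 - s)"
        by (simp add: field_simps)
      finally show ?thesis by simp
    qed
    then have "ennreal (C' * real m powr (real d * ((1 + \<theta>) / 2 - s)))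
        = ennreal (C * N * \<sigma> powr (real d * (\<theta> - 1))) / schatten_norm r (indicator S)"
      unfolding den using C N by (simp add: divide_ennreal)
    also have "\<dots> \<le> mixed_wiener_norm g q I a p (evolved_density U (indicator S) f) / schatten_norm r (indicator S)"
      by (rule divide_right_mono_ennreal[OF num])
    finally show "\<exists>\<gamma> \<alpha> f. spectral_form \<gamma> \<alpha> f \<and> schatten_coefficients r \<alpha> \<and> operator_nonzero \<gamma> \<and>
        density_defined U I \<alpha> f \<and>
        ennreal (C' * real m powr (real DIM('a) * ((1 + enn2real (inverse p)) / 2 - enn2real (inverse r))))
          \<le> mixed_wiener_norm g q I a p (evolved_density U \<alpha> f) / schatten_norm r \<alpha>"
      unfolding d_def \<theta>_def s_def
      using spectral_form_projection[OF f_orth S_fin] schatten_coefficients_indicator[OF S_fin S_ne, of r]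
        operator_nonzero_projection[OF f_orth S_fin S_ne] density_defined_indicator[OF U, of f S I, OF fL2 S_fin]
      by blast
  qed
qed

lemma conjugate_exponent_ge_1: "1 \<le> conjugate_exponent p"
proof -
  have "1 - inverse p \<le> 1" by (rule diff_le_self_ennreal)
  then obtain x where x: "1 - inverse p = ennreal x" "0 \<le> x" "x \<le> 1"
    by (cases "1 - inverse p") (auto simp: top_unique)
  then show ?thesis
    by (cases "x = 0") (auto simp: conjugate_exponent_def inverse_ennreal one_le_inverse)
qed

text \<open>The assumption on \<open>r\<close> says exactly that the exponent of \<open>m\<close> in \<open>hermite_projection_ratio\<close> is
  positive.\<close>

lemma inverse_exponent_less:
  assumes "1 \<le> p" "p \<noteq> \<infinity>" "2 * p / (p + 1) < r"
  shows "enn2real (inverse r) < (1 + enn2real (inverse p)) / 2"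
proof -
  obtain P where P: "p = ennreal P" "P \<ge> 1" using assms by (cases p) auto
  have "2 * p = ennreal (2 * P)" "p + 1 = ennreal (P + 1)"
    using P by (simp_all add: ennreal_mult')
  then have eq: "2 * p / (p + 1) = ennreal (2 * P / (P + 1))"
    using P by (simp only: divide_ennreal)
  have \<theta>: "enn2real (inverse p) = 1 / P" using P by (simp add: inverse_ennreal inverse_eq_divide)
  show ?thesis
  proof (cases "r = \<infinity>")
    case True
    then show ?thesis using P \<theta> by (simp add: add_pos_nonneg)
  next
    case False
    then obtain R where R: "r = ennreal R" "R \<ge> 0" by (cases r) auto
    then have less: "2 * P / (P + 1) < R" using assms(3) P unfolding eq by (simp add: ennreal_less_iff)
    moreover have "2 * P / (P + 1) > 0" using P by simp
    moreover have "R > 0" using calculation by linarith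
    ultimately have "1 / R < 1 / (2 * P / (P + 1))"
      by (intro divide_strict_left_mono mult_pos_pos) auto
    also have "\<dots> = (1 + 1 / P) / 2" using P by (simp add: field_simps)
    finally have "1 / R < (1 + enn2real (inverse p)) / 2" unfolding \<theta> .
    moreover have "R > 0" using less \<open>2 * P / (P + 1) > 0\<close> by linarith
    ultimately show ?thesis using R by (simp add: inverse_ennreal inverse_eq_divide)
  qed
qed

theorem theorem5p3:
  fixes g :: "real ^ 'n \<Rightarrow> complex"
    and U :: "real \<Rightarrow> (real ^ 'n \<Rightarrow> complex) \<Rightarrow> real ^ 'n \<Rightarrow> complex"
    and d :: nat
    and p q r :: ennreal
    and I :: "real set"
  assumes "d = CARD('n)"
    and "I = {- pi / 4 <..< pi / 4}"
    and "test_function g" and "g \<noteq> (\<lambda>_. 0)"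
    and "generates_unitary_group harmonic_oscillator U"
    and "1 \<le> p" and "1 \<le> q"
    and "2 / q + of_nat d / p = of_nat d"
    and "p < (of_nat d + 1) / (of_nat d - 1)"
    and "2 * p / (p + 1) < r"
  shows "Sup {mixed_wiener_norm g q I (conjugate_exponent p) p (evolved_density U \<alpha> f)
                / schatten_norm r \<alpha> | \<gamma> \<alpha> f.
           spectral_form \<gamma> \<alpha> f \<and> schatten_coefficients r \<alpha> \<and> operator_nonzero \<gamma> \<and>
           density_defined U I \<alpha> f} = \<infinity>"
    (is "Sup ?X = \<infinity>")
proof (rule ccontr)
  assume "Sup ?X \<noteq> \<infinity>"
  then obtain l where l: "Sup ?X = ennreal l" "l \<ge> 0" by (cases "Sup ?X") auto
  have "p \<noteq> \<infinity>" using assms(9) by auto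
  define \<eta> where "\<eta> = real DIM(real ^ 'n) * ((1 + enn2real (inverse p)) / 2 - enn2real (inverse r))"
  have \<eta>: "\<eta> > 0"
    using inverse_exponent_less[OF assms(6) \<open>p \<noteq> \<infinity>\<close> assms(10)] by (simp add: \<eta>_def)
  have "emeasure lborel I = ennreal (pi / 2)" unfolding assms(2) by (subst emeasure_lborel_Ioo) auto
  then have I: "I \<in> sets lborel" "1 \<le> emeasure lborel I" using pi_ge_two assms(2) by auto
  have "0 < q" using assms(7) by (metis less_le_trans zero_less_one)
  obtain C where C: "C > 0"
    and ratio: "\<And>m. m > 0 \<Longrightarrow> \<exists>\<gamma> \<alpha> f. spectral_form \<gamma> \<alpha> f \<and> schatten_coefficients r \<alpha> \<and> operator_nonzero \<gamma> \<and>
        density_defined U I \<alpha> f \<and> ennreal (C * real m powr \<eta>)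
          \<le> mixed_wiener_norm g q I (conjugate_exponent p) p (evolved_density U \<alpha> f) / schatten_norm r \<alpha>"
    using hermite_projection_ratio[OF assms(5,3,4) conjugate_exponent_ge_1 assms(6) \<open>0 < q\<close> I]
    unfolding \<eta>_def by blast
  obtain m :: nat where m_gt: "(l / C + 1) powr (1 / \<eta>) < real m" using reals_Archimedean2 by blast
  have pos: "l / C + 1 > 0" using l C by (simp add: add_nonneg_pos)
  then have "(l / C + 1) powr (1 / \<eta>) > 0" by simp
  with m_gt have "real m > 0" by linarith
  then have m: "m > 0" by simp
  have "l / C < ((l / C + 1) powr (1 / \<eta>)) powr \<eta>" using pos \<eta> by (simp add: powr_powr)
  also have "\<dots> < real m powr \<eta>" using m_gt \<eta> by (intro powr_less_mono2) auto
  finally have large: "l / C < real m powr \<eta>" .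
  obtain \<gamma> \<alpha> f where "spectral_form \<gamma> \<alpha> f" "schatten_coefficients r \<alpha>" "operator_nonzero \<gamma>" "density_defined U I \<alpha> f"
    and le: "ennreal (C * real m powr \<eta>)
          \<le> mixed_wiener_norm g q I (conjugate_exponent p) p (evolved_density U \<alpha> f) / schatten_norm r \<alpha>"
    using ratio[OF m] by blast
  then have "mixed_wiener_norm g q I (conjugate_exponent p) p (evolved_density U \<alpha> f) / schatten_norm r \<alpha> \<le> Sup ?X"
    by (intro Sup_upper) blast
  with le have "ennreal (C * real m powr \<eta>) \<le> ennreal l" unfolding l by (rule order_trans)
  then have "C * real m powr \<eta> \<le> l" using l by simp
  moreover have "l < C * real m powr \<eta>" using large C by (simp add: field_simps)
  ultimately show False by linarith
qed

end
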